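(* Let $X$ be a Banach space, $k\in\mathbb{N}$, and $(x_s)_{s\in[\mathbb{N}]^k}$ a weakly relatively compact $k$-sequence in $X$. Then there exists an infinite $M\subseteq\mathbb{N}$ such that at least one of the following holds: (1) $(x_s)_{s\in[M]^k}$ generates a $k$-spreading model equivalent to the usual basis of $\ell^1$; (2) there exists $x_0\in X$ such that for every infinite $L\subseteq M$, $(x_s)_{s\in[L]^k}$ is $k$-Cesàro summable to $x_0$.
   Context: $[M]^k$: $k$-subsets of $M\subseteq\mathbb{N}$ (increasing enumerations, $M(l)$ the $l$-th element); $M|n=\{M(1),\dots,M(n)\}$. A $k$-sequence is a map $[\mathbb{N}]^k\to X$; it is weakly relatively compact if the weak closure of $\{x_s:s\in[\mathbb{N}]^k\}$ is weakly compact. Plegma family: $(s_j)_{j=1}^l$ in $[M]^k$ with $s_1(i)<\dots<s_l(i)$ ($i\le k$), $s_l(i)<s_1(i+1)$ ($i<k$). $(x_s)_{s\in[M]^k}$ generates the Hamel basis $(e_n)$ of a seminormed space $(E,\|\cdot\|_* )$ as a $k$-spreading model if for a null sequence $\delta_l>0$: $|\|\sum_{j=1}^m a_jx_{s_j}\|-\|\sum_{j=1}^m a_je_j\|_*|\le\delta_l$ for all $m\le l$, plegma $(s_j)_{j=1}^m$ in $[M]^k$ with $s_1(1)\ge M(l)$, $a_j\in[-1,1]$. $(x_s)_{s\in[L]^k}$ is $k$-Cesàro summable to $x_0$ if $\binom{n}{k}^{-1}\sum_{s\in[L|n]^k}x_s\to x_0$ in norm. *)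

theory Defs
  imports "HOL-Analysis.Analysis" "HOL-Library.Infinite_Set"
begin

definition weak_top :: "'a::real_normed_vector topology" where
  "weak_top = topology_generated_by
     {f -` U | (f :: 'a \<Rightarrow> real) U. bounded_linear f \<and> open U}"

definition ksubsets :: "nat set \<Rightarrow> nat \<Rightarrow> nat set set" where
  "ksubsets M k = {s. finite s \<and> card s = k \<and> s \<subseteq> M}"

text \<open>l-th element (1-indexed) of a finite set s in increasing order: s(l)\<close>
definition fel :: "nat set \<Rightarrow> nat \<Rightarrow> nat" where
  "fel s l = sorted_list_of_set s ! (l - 1)"

text \<open>l-th element (1-indexed) of an infinite set M in increasing order: M(l)\<close>
definition iel :: "nat set \<Rightarrow> nat \<Rightarrow> nat" where
  "iel M l = Infinite_Set.enumerate M (l - 1)"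

definition initseg :: "nat set \<Rightarrow> nat \<Rightarrow> nat set" where
  "initseg M n = iel M ` {1..n}"

definition plegma :: "nat set \<Rightarrow> nat \<Rightarrow> nat \<Rightarrow> (nat \<Rightarrow> nat set) \<Rightarrow> bool" where
  "plegma M k l ss \<longleftrightarrow>
     (\<forall>j\<in>{1..l}. ss j \<in> ksubsets M k) \<and>
     (\<forall>i\<in>{1..k}. \<forall>j\<in>{1..<l}. fel (ss j) i < fel (ss (Suc j)) i) \<and>
     (\<forall>i\<in>{1..<k}. fel (ss l) i < fel (ss 1) (Suc i))"

text \<open>Elements of the space E with Hamel basis (e_n)_{n\<ge>1}: finitely supported coefficient
  sequences a (a represents sum_n a n e_n), indexed from 1.\<close>
definition fincoeff :: "(nat \<Rightarrow> real) \<Rightarrow> bool" where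
  "fincoeff a \<longleftrightarrow> (\<exists>n. \<forall>j. a j \<noteq> 0 \<longrightarrow> j \<in> {1..n})"

text \<open>N is a seminorm on E (N a = ||sum a_n e_n||_* ).\<close>
definition seminorm_on_E :: "((nat \<Rightarrow> real) \<Rightarrow> real) \<Rightarrow> bool" where
  "seminorm_on_E N \<longleftrightarrow>
     (\<forall>a b. fincoeff a \<and> fincoeff b \<longrightarrow> N (\<lambda>j. a j + b j) \<le> N a + N b) \<and>
     (\<forall>a c. fincoeff a \<longrightarrow> N (\<lambda>j. c * a j) = \<bar>c\<bar> * N a)"

definition generates_spreading_model ::
  "(nat set \<Rightarrow> 'a::real_normed_vector) \<Rightarrow> nat set \<Rightarrow> nat \<Rightarrow> ((nat \<Rightarrow> real) \<Rightarrow> real) \<Rightarrow> bool" where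
  "generates_spreading_model x M k N \<longleftrightarrow>
     seminorm_on_E N \<and>
     (\<exists>\<delta> :: nat \<Rightarrow> real. (\<forall>l. \<delta> l > 0) \<and> \<delta> \<longlonglongrightarrow> 0 \<and>
       (\<forall>l m ss a. 1 \<le> l \<and> 1 \<le> m \<and> m \<le> l \<and> plegma M k m ss \<and> fel (ss 1) 1 \<ge> iel M l \<and>
          (\<forall>j\<in>{1..m}. \<bar>a j\<bar> \<le> 1) \<and> (\<forall>j. j \<notin> {1..m} \<longrightarrow> a j = 0) \<longrightarrow>
          \<bar>norm (\<Sum>j=1..m. a j *\<^sub>R x (ss j)) - N a\<bar> \<le> \<delta> l))"

definition equiv_l1_basis :: "((nat \<Rightarrow> real) \<Rightarrow> real) \<Rightarrow> bool" where
  "equiv_l1_basis N \<longleftrightarrow> (\<exists>c C. 0 < c \<and> 0 < C \<and>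
     (\<forall>a. fincoeff a \<longrightarrow>
        c * (\<Sum>j\<in>{j. a j \<noteq> 0}. \<bar>a j\<bar>) \<le> N a \<and> N a \<le> C * (\<Sum>j\<in>{j. a j \<noteq> 0}. \<bar>a j\<bar>)))"

definition cesaro_summable ::
  "(nat set \<Rightarrow> 'a::real_normed_vector) \<Rightarrow> nat set \<Rightarrow> nat \<Rightarrow> 'a \<Rightarrow> bool" where
  "cesaro_summable x L k x0 \<longleftrightarrow>
     (\<lambda>n. (1 / real (n choose k)) *\<^sub>R (\<Sum>s\<in>ksubsets (initseg L n) k. x s)) \<longlonglongrightarrow> x0"

end

theory Submission
  imports Defs "HOL-Library.Ramsey"
begin

text \<open>
  Ramsey's theorem and a diagonal argument give an infinite \<open>M\<close> along which
  \<open>norm (a\<^sub>1 x(s\<^sub>1) + \<dots> + a\<^sub>m x(s\<^sub>m) - z)\<close> stabilises on plegma families, for all coefficients and for all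
  \<open>z\<close> in a countable set dense in the span of the sequence; \<open>z = 0\<close> yields the spreading model. Weak
  compactness provides iterated weak cluster points \<open>x(t)\<close> for \<open>t \<subseteq> M\<close> with fewer than \<open>k\<close> elements; put
  \<open>x\<^sub>0 = x(\<emptyset>)\<close>.

  By the spreading property, a lower \<open>\<ell>\<^sup>1\<close>-estimate for coefficients of sum zero implies one for all
  coefficients. If there is none, some \<open>b\<close> with sum zero and \<open>\<Sum>\<bar>b\<^sub>j\<bar> = 1\<close> has small norm in the
  spreading model. By Mazur's lemma, every \<open>x(s\<^sub>j)\<close> with \<open>b\<^sub>j < 0\<close> can be averaged out to \<open>x\<^sub>0\<close> without moving
  the other members of the plegma family. So the convex combination with coefficients \<open>2 b\<^sub>j\<^sup>+\<close> is
  close to \<open>x\<^sub>0\<close> on some plegma family, hence on all plegma families that start late enough. Averaging over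
  the plegma families formed by shifts of well spaced \<open>k\<close>-sets turns this into Cesaro convergence.
\<close>

section \<open>Hahn-Banach separation and weak compactness\<close>

text \<open>The point \<open>x\<^sub>0\<close> is made from cluster points along \<open>M\<close>,
  so it is unknown while \<open>M\<close> is being thinned out. The stabilisation has to cover it in
  advance: all multiples of \<open>x\<^sub>0\<close> turn out to lie in the closed span of the
  sequence, and a bound for centres in a countable dense set passes to its closure because the norm
  is 1-Lipschitz in the centre. Sum zero makes the replacement work: the positive and the negative
  part of \<open>b\<close> both have mass 1/2, so averaging out the negative entries leaves the norm
  of \<open>\<Sum>b\<^sub>j\<^sup>+ x(s\<^sub>j) - x\<^sub>0 / 2\<close>, and doubling produces a
  convex combination minus \<open>x\<^sub>0\<close>. A member of a plegma family is interlaced with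
  the others, so it cannot be averaged as a whole: its elements are chosen one by one between the
  fixed ones, which is why the limits are iterated. Cesaro summability holds along every
  \<open>L\<close> inside \<open>M\<close> because the closeness is uniform over all late plegma
  families in \<open>M\<close>, and those in \<open>L\<close> are among them.\<close>

text \<open>Homogeneity is demanded only as an inequality; the converse comes from
  \<open>inverse c\<close>, so a functional built as an infimum needs just the one bound.\<close>

definition sublinear :: "('a::real_vector \<Rightarrow> real) \<Rightarrow> bool" where
  "sublinear p \<longleftrightarrow> (\<forall>x y. p (x + y) \<le> p x + p y) \<and> (\<forall>c x. 0 < c \<longrightarrow> p (c *\<^sub>R x) \<le> c * p x) \<and> p 0 = 0"

lemma sublinear_scale:
  assumes "sublinear p" "0 < c"
  shows "p (c *\<^sub>R x) = c * p x"
proof (rule antisym)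
  show "p (c *\<^sub>R x) \<le> c * p x"
    using assms by (auto simp: sublinear_def)
  have "p (inverse c *\<^sub>R (c *\<^sub>R x)) \<le> inverse c * p (c *\<^sub>R x)"
    using assms by (metis positive_imp_inverse_positive sublinear_def)
  then show "c * p x \<le> p (c *\<^sub>R x)"
    using assms by (simp add: field_simps)
qed

lemma sublinear_lower_bound:
  assumes "sublinear p"
  shows "- p (- x) \<le> p x"
proof -
  have "p (x + - x) \<le> p x + p (- x)" and "p 0 = 0" using assms unfolding sublinear_def by blast+
  then show ?thesis by simp
qed

text \<open>Zorn's lemma with the order reversed. A chain has a finite pointwise infimum because
  every sublinear \<open>q \<le> p\<close> satisfies \<open>- p (- x) \<le> q x\<close>, and that
  infimum is subadditive because two members of a chain have a common lower one in it.\<close>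

lemma minimal_sublinear_below:
  fixes p :: "'a::real_vector \<Rightarrow> real"
  assumes p: "sublinear p"
  obtains q where "sublinear q" "q \<le> p" "\<And>r. sublinear r \<Longrightarrow> r \<le> q \<Longrightarrow> r = q"
proof -
  define A where "A = {q. sublinear q \<and> q \<le> p}"
  have "\<exists>m\<in>A. \<forall>a\<in>A. a \<le> m \<longrightarrow> a = m"
  proof (rule predicate_Zorn)
    show "partial_order_on A (relation_of (\<lambda>a b. b \<le> a) A)"
      by (rule partial_order_on_relation_ofI) auto
  next
    fix C assume C: "C \<in> Chains (relation_of (\<lambda>a b. b \<le> a) A)"
    then have CA: "C \<subseteq> A" and tot: "\<And>a b. a \<in> C \<Longrightarrow> b \<in> C \<Longrightarrow> a \<le> b \<or> b \<le> a"
      unfolding Chains_def relation_of_def by blast+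
    show "\<exists>u\<in>A. \<forall>a\<in>C. u \<le> a"
    proof (cases "C = {}")
      case True
      then show ?thesis using p by (auto simp: A_def)
    next
      case ne: False
      define u where "u x = (INF q\<in>C. q x)" for x
      have bdd: "bdd_below ((\<lambda>q. q x) ` C)" for x
      proof (rule bdd_belowI2)
        fix q assume "q \<in> C"
        then have "sublinear q" "q \<le> p" using CA by (auto simp: A_def)
        then show "- p (- x) \<le> q x"
          using sublinear_lower_bound[of q x] by (meson le_fun_def neg_le_iff_le order_trans)
      qed
      have le: "u x \<le> q x" if "q \<in> C" for q x
        unfolding u_def using that bdd by (rule cINF_lower[rotated])
      have ge: "b \<le> u x" if "\<And>q. q \<in> C \<Longrightarrow> b \<le> q x" for b x
        unfolding u_def using that ne by (intro cINF_greatest)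
      have sub: "sublinear q" if "q \<in> C" for q using that CA by (auto simp: A_def)
      have add: "u (x + y) \<le> u x + u y" for x y
      proof -
        have "u (x + y) \<le> q x + r y" if qr: "q \<in> C" "r \<in> C" for q r
        proof -
          obtain s where s: "s \<in> C" "s \<le> q" "s \<le> r" using tot[OF qr] qr by auto
          have "u (x + y) \<le> s (x + y)" using s le by auto
          also have "\<dots> \<le> s x + s y" using sub[OF s(1)] by (auto simp: sublinear_def)
          also have "\<dots> \<le> q x + r y" using s by (simp add: le_fun_def add_mono)
          finally show ?thesis .
        qed
        then have "u (x + y) - r y \<le> u x" if "r \<in> C" for r
          using that by (intro ge) (simp add: algebra_simps)
        then have "u (x + y) - u x \<le> u y"
          by (intro ge) (simp add: algebra_simps)
        then show ?thesis by simp
      qed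
      have scale: "u (c *\<^sub>R x) \<le> c * u x" if "0 < c" for c x
      proof -
        have "u (c *\<^sub>R x) / c \<le> u x"
        proof (rule ge)
          fix q assume q: "q \<in> C"
          have "u (c *\<^sub>R x) \<le> q (c *\<^sub>R x)" by (rule le[OF q])
          also have "\<dots> = c * q x" using sublinear_scale sub[OF q] that by blast
          finally show "u (c *\<^sub>R x) / c \<le> q x" using that by (simp add: field_simps)
        qed
        then show ?thesis using that by (simp add: field_simps)
      qed
      have zero: "u 0 = 0"
      proof (rule antisym)
        obtain q where "q \<in> C" using ne by auto
        then show "u 0 \<le> 0" using le[of q 0] sub[of q] by (simp add: sublinear_def)
        have "q 0 = 0" if "q \<in> C" for q using sub[OF that] by (simp add: sublinear_def)
        then show "0 \<le> u 0" by (intro ge) (metis order_refl)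
      qed
      have "u \<le> p"
      proof -
        obtain q where "q \<in> C" using ne by auto
        then show ?thesis using le[of q] CA unfolding A_def le_fun_def by (blast intro: order_trans)
      qed
      then have "u \<in> A" using add scale zero by (auto simp: A_def sublinear_def)
      then show ?thesis using le by (auto simp: le_fun_def)
    qed
  qed
  then obtain q where q: "q \<in> A" "\<forall>a\<in>A. a \<le> q \<longrightarrow> a = q" by blast
  show thesis
  proof
    show "sublinear q" "q \<le> p" using q(1) by (auto simp: A_def)
    fix r assume "sublinear r" "r \<le> q"
    then show "r = q" using q by (auto simp: A_def)
  qed
qed

text \<open>For fixed \<open>y\<close>, the infimum over \<open>t \<ge> 0\<close> of
  \<open>q (x + t y) - t q y\<close> is sublinear in \<open>x\<close> and at most \<open>q\<close>,
  hence equal to \<open>q\<close> by minimality; its term at \<open>t = 1\<close> gives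
  superadditivity.\<close>

lemma minimal_sublinear_imp_linear:
  fixes q :: "'a::real_vector \<Rightarrow> real"
  assumes q: "sublinear q" and min: "\<And>r. sublinear r \<Longrightarrow> r \<le> q \<Longrightarrow> r = q"
  shows "linear q"
proof -
  have qadd: "q (x + y) \<le> q x + q y" for x y using q by (auto simp: sublinear_def)
  have qscale: "q (c *\<^sub>R x) = c * q x" if "0 \<le> c" for c x
  proof (cases "c = 0")
    case True
    then show ?thesis using q by (simp add: sublinear_def)
  next
    case False
    then show ?thesis using sublinear_scale[OF q, of c] that by simp
  qed
  have super: "q x + q y \<le> q (x + y)" for x y
  proof -
    define r where "r x = (INF t\<in>{0..}. q (x + t *\<^sub>R y) - t * q y)" for x
    have bdd: "bdd_below ((\<lambda>t. q (x + t *\<^sub>R y) - t * q y) ` {0..})" for x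
    proof (rule bdd_belowI2)
      fix t :: real assume "t \<in> {0..}"
      then have "t * q y = q (x + t *\<^sub>R y + (- x))" using qscale[of t y] by simp
      then show "- q (- x) \<le> q (x + t *\<^sub>R y) - t * q y"
        using qadd[of "x + t *\<^sub>R y" "- x"] by simp
    qed
    have le: "r x \<le> q (x + t *\<^sub>R y) - t * q y" if "0 \<le> t" for t x
      unfolding r_def using that bdd by (intro cINF_lower) auto
    have ge: "b \<le> r x" if "\<And>t. 0 \<le> t \<Longrightarrow> b \<le> q (x + t *\<^sub>R y) - t * q y" for b x
      unfolding r_def using that by (intro cINF_greatest) auto
    have radd: "r (x + x') \<le> r x + r x'" for x x'
    proof -
      have "r (x + x') \<le> (q (x + t *\<^sub>R y) - t * q y) + (q (x' + t' *\<^sub>R y) - t' * q y)"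
        if "0 \<le> t" "0 \<le> t'" for t t'
        using le[of "t + t'" "x + x'"] that qadd[of "x + t *\<^sub>R y" "x' + t' *\<^sub>R y"]
        by (simp add: algebra_simps)
      then have "r (x + x') - (q (x' + t' *\<^sub>R y) - t' * q y) \<le> r x" if "0 \<le> t'" for t'
        using that by (intro ge) (simp add: algebra_simps)
      then have "r (x + x') - r x \<le> r x'"
        by (intro ge) (simp add: algebra_simps)
      then show ?thesis by simp
    qed
    have rscale: "r (c *\<^sub>R x) \<le> c * r x" if c: "0 < c" for c x
    proof -
      have "r (c *\<^sub>R x) / c \<le> r x"
      proof (rule ge)
        fix t :: real assume t: "0 \<le> t"
        have "r (c *\<^sub>R x) \<le> q (c *\<^sub>R (x + t *\<^sub>R y)) - (c * t) * q y"
          using le[of "c * t" "c *\<^sub>R x"] t c by (simp add: scaleR_right_distrib)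
        also have "\<dots> = c * (q (x + t *\<^sub>R y) - t * q y)"
          using qscale[of c "x + t *\<^sub>R y"] c by (simp add: right_diff_distrib)
        finally show "r (c *\<^sub>R x) / c \<le> q (x + t *\<^sub>R y) - t * q y"
          using c by (simp add: field_simps)
      qed
      then show ?thesis using c by (simp add: field_simps)
    qed
    have "r 0 = 0"
    proof (rule antisym)
      show "r 0 \<le> 0" using le[of 0 0] qscale[of 0 0] by simp
      show "0 \<le> r 0" using qscale[of _ y] by (intro ge) simp
    qed
    then have "sublinear r" using radd rscale by (auto simp: sublinear_def)
    moreover have "r \<le> q" using le[of 0] by (simp add: le_fun_def)
    ultimately have "r = q" by (rule min)
    then show ?thesis using le[of 1 x] by simp
  qed
  have add: "q (x + y) = q x + q y" for x y
    using qadd super by (intro antisym) auto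
  have neg: "q (- x) = - q x" for x
    using add[of x "- x"] qscale[of 0 0] by simp
  show ?thesis
  proof (rule linearI)
    fix c :: real and x
    show "q (c *\<^sub>R x) = c *\<^sub>R q x"
      using qscale[of c x] qscale[of "- c" x] neg[of "(- c) *\<^sub>R x"] by (cases "0 \<le> c") auto
  qed (rule add)
qed

text \<open>Among sublinear functionals below the norm, \<open>p\<close> is the largest with
  \<open>p (- c) \<le> - d\<close> on \<open>C\<close>. A linear \<open>f \<le> p\<close> therefore
  satisfies both conclusions, the second through \<open>f c = - f (- c)\<close>. Convexity of
  \<open>C\<close> yields subadditivity, and \<open>d \<le> norm c\<close> yields
  \<open>p 0 = 0\<close>.\<close>

lemma Hahn_Banach_separation:
  fixes C :: "'a::real_normed_vector set"
  assumes C: "convex C" "C \<noteq> {}" and d: "\<And>c. c \<in> C \<Longrightarrow> d \<le> norm c"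
  obtains f where "bounded_linear f" "\<And>x. f x \<le> norm x" "\<And>c. c \<in> C \<Longrightarrow> d \<le> f c"
proof -
  define p where "p x = (INF (c, t)\<in>C \<times> {0..}. norm (x + t *\<^sub>R c) - t * d)" for x
  have bdd: "bdd_below ((\<lambda>(c, t). norm (x + t *\<^sub>R c) - t * d) ` (C \<times> {0..}))" for x
  proof (rule bdd_belowI2, clarify)
    fix c and t :: real assume "c \<in> C" "0 \<le> t"
    have "t * d \<le> norm (t *\<^sub>R c)" using d[OF \<open>c \<in> C\<close>] \<open>0 \<le> t\<close> by (simp add: mult_left_mono)
    also have "\<dots> \<le> norm (x + t *\<^sub>R c) + norm x"
      using norm_triangle_ineq4[of "x + t *\<^sub>R c" x] by simp
    finally show "- norm x \<le> norm (x + t *\<^sub>R c) - t * d" by simp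
  qed
  have le: "p x \<le> norm (x + t *\<^sub>R c) - t * d" if "c \<in> C" "0 \<le> t" for x c t
    using cINF_lower[OF bdd, of "(c, t)"] that unfolding p_def by auto
  have ge: "b \<le> p x" if "\<And>c t. c \<in> C \<Longrightarrow> 0 \<le> t \<Longrightarrow> b \<le> norm (x + t *\<^sub>R c) - t * d" for b x
    unfolding p_def using that C(2) by (intro cINF_greatest) auto
  have padd: "p (x + x') \<le> p x + p x'" for x x'
  proof -
    have "p (x + x') \<le> (norm (x + t *\<^sub>R c) - t * d) + (norm (x' + t' *\<^sub>R c') - t' * d)"
      if ct: "c \<in> C" "0 \<le> t" "c' \<in> C" "0 \<le> t'" for c t c' t'
    proof -
      \<comment> \<open>Convexity merges the two rays: \<open>t c + t' c'\<close> is
        \<open>t + t'\<close> times a point of \<open>C\<close>, and for \<open>t + t' = 0\<close>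
        any point serves.\<close>
      obtain c'' where c'': "c'' \<in> C" "(t + t') *\<^sub>R c'' = t *\<^sub>R c + t' *\<^sub>R c'"
      proof (cases "t + t' = 0")
        case True
        then have "t = 0" "t' = 0" using ct by auto
        then show thesis using ct(1) by (intro that[of c]) auto
      next
        case False
        then have pos: "0 < t + t'" using ct by auto
        let ?c = "(t / (t + t')) *\<^sub>R c + (t' / (t + t')) *\<^sub>R c'"
        have "?c \<in> C"
          using pos ct by (intro convexD[OF C(1)]) (auto simp: add_divide_distrib[symmetric])
        moreover have "(t + t') *\<^sub>R ?c = t *\<^sub>R c + t' *\<^sub>R c'"
          using pos by (simp add: scaleR_right_distrib)
        ultimately show thesis by (rule that)
      qed
      have "p (x + x') \<le> norm (x + x' + (t + t') *\<^sub>R c'') - (t + t') * d"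
        using c''(1) ct by (intro le) auto
      also have "x + x' + (t + t') *\<^sub>R c'' = (x + t *\<^sub>R c) + (x' + t' *\<^sub>R c')"
        using c''(2) by (simp add: algebra_simps)
      finally show ?thesis
        using norm_triangle_ineq[of "x + t *\<^sub>R c" "x' + t' *\<^sub>R c'"] by (simp add: algebra_simps)
    qed
    then have "p (x + x') - (norm (x' + t' *\<^sub>R c') - t' * d) \<le> p x" if "c' \<in> C" "0 \<le> t'" for c' t'
      using that by (intro ge) (smt (verit))
    then have "p (x + x') - p x \<le> p x'"
      by (intro ge) (smt (verit))
    then show ?thesis by simp
  qed
  have pscale: "p (s *\<^sub>R x) \<le> s * p x" if s: "0 < s" for s x
  proof -
    have "p (s *\<^sub>R x) / s \<le> p x"
    proof (rule ge)
      fix c t assume c: "c \<in> C" "0 \<le> (t::real)"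
      have "p (s *\<^sub>R x) \<le> norm (s *\<^sub>R (x + t *\<^sub>R c)) - (s * t) * d"
        using le[of c "s * t" "s *\<^sub>R x"] c s by (simp add: scaleR_right_distrib)
      also have "\<dots> = s * (norm (x + t *\<^sub>R c) - t * d)"
        using s by (simp add: right_diff_distrib del: scaleR_right_distrib)
      finally show "p (s *\<^sub>R x) / s \<le> norm (x + t *\<^sub>R c) - t * d"
        using s by (simp add: field_simps)
    qed
    then show ?thesis using s by (simp add: field_simps)
  qed
  have pnorm: "p x \<le> norm x" for x
    using C(2) le[of _ 0 x] by auto
  have "0 \<le> p 0"
  proof (rule ge)
    fix c t assume "c \<in> C" "0 \<le> (t::real)"
    then show "0 \<le> norm (0 + t *\<^sub>R c) - t * d" using d[of c] by (simp add: mult_left_mono)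
  qed
  then have "p 0 = 0" using pnorm[of 0] by simp
  then have "sublinear p" using padd pscale by (auto simp: sublinear_def)
  then obtain f where "sublinear f" and fp: "f \<le> p" and "\<And>r. sublinear r \<Longrightarrow> r \<le> f \<Longrightarrow> r = f"
    by (rule minimal_sublinear_below) blast
  then have lin: "linear f" by (intro minimal_sublinear_imp_linear)
  have fnorm: "f x \<le> norm x" for x using fp pnorm[of x] by (meson le_fun_def order_trans)
  show thesis
  proof
    show "bounded_linear f"
      unfolding bounded_linear_def bounded_linear_axioms_def
    proof (intro conjI exI allI lin)
      fix x
      show "norm (f x) \<le> norm x * 1"
        using fnorm[of x] fnorm[of "- x"] linear_neg[OF lin, of x] by (simp add: abs_le_iff)
    qed
    fix c assume "c \<in> C"
    then have "f (- c) \<le> - d"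
      using fp le[of c 1 "- c"] by (simp add: le_fun_def) (meson order_trans)
    then show "d \<le> f c" using linear_neg[OF lin, of c] by simp
  qed (rule fnorm)
qed

section \<open>The weak topology: Mazur's lemma, boundedness, cluster points\<close>

lemma topspace_weak_top [simp]: "topspace weak_top = UNIV"
proof -
  have "(\<lambda>_::'a. 0::real) -` UNIV \<in> {f -` U |f U. bounded_linear f \<and> open U}"
    by (rule CollectI, intro exI[of _ "\<lambda>_. 0"] exI[of _ UNIV]) auto
  then show ?thesis unfolding weak_top_def topology_generated_by_topspace by auto
qed

lemma openin_weak_top_vimage:
  assumes "bounded_linear (f :: 'a::real_normed_vector \<Rightarrow> real)" "open U"
  shows "openin weak_top (f -` U)"
  unfolding weak_top_def by (rule topology_generated_by_Basis) (use assms in blast)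

text \<open>If the convex hull of \<open>A\<close> stayed at distance \<open>e\<close> from
  \<open>y\<close>, a functional would exceed its value at \<open>y\<close> by at least
  \<open>e\<close> on all of \<open>A\<close>, and a weakly open half-space around \<open>y\<close>
  would miss \<open>A\<close>.\<close>

lemma Mazur:
  fixes y :: "'a::real_normed_vector"
  assumes y: "y \<in> weak_top closure_of A" and e: "0 < e"
  shows "\<exists>z\<in>convex hull A. norm (z - y) < e"
proof (rule ccontr)
  assume neg: "\<not> ?thesis"
  define C where "C = (\<lambda>z. - y + z) ` (convex hull A)"
  have "A \<noteq> {}" using y by auto
  have "convex C" unfolding C_def by (intro convex_translation convex_convex_hull)
  moreover have "C \<noteq> {}" using \<open>A \<noteq> {}\<close> by (simp add: C_def)
  moreover have "e \<le> norm c" if "c \<in> C" for c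
    using that neg unfolding C_def by (force simp: not_less)
  ultimately obtain f where f: "bounded_linear f" "\<And>c. c \<in> C \<Longrightarrow> e \<le> f c"
    using Hahn_Banach_separation by metis
  have "openin weak_top (f -` {..<f y + e})"
    using f by (intro openin_weak_top_vimage) auto
  moreover have "y \<in> f -` {..<f y + e}" using e by simp
  ultimately obtain a where "a \<in> A" "a \<in> f -` {..<f y + e}"
    using y unfolding in_closure_of by meson
  then have a: "a \<in> A" "f a < f y + e" by simp_all
  then have "- y + a \<in> C" by (auto simp: C_def hull_inc)
  then have "e \<le> f (- y + a)" by (rule f)
  also have "\<dots> = f a - f y"
    using linear_diff[OF bounded_linear.linear[OF f(1)], of a y] by simp
  finally show False using a by simp
qed

text \<open>The uniform boundedness principle: each functional is bounded on \<open>K\<close>, being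
  weakly continuous, and Baire's theorem in the dual space makes the bound uniform on a ball of
  functionals.\<close>

lemma compactin_weak_top_imp_bounded:
  fixes K :: "'a::real_normed_vector set"
  assumes K: "compactin weak_top K"
  shows "bounded K"
proof -
  have fK: "\<exists>B. \<forall>x\<in>K. \<bar>blinfun_apply f x\<bar> \<le> B" for f :: "'a \<Rightarrow>\<^sub>L real"
  proof -
    have "continuous_map weak_top euclidean (blinfun_apply f)"
      unfolding continuous_map_def
      using openin_weak_top_vimage[OF blinfun.bounded_linear_right[of f]] by (auto simp: vimage_def)
    then have "compactin euclidean (blinfun_apply f ` K)" by (rule image_compactin[OF K])
    then have "bounded (blinfun_apply f ` K)" by (simp add: compact_imp_bounded)
    then show ?thesis unfolding bounded_iff by auto
  qed
  define E where "E n = {f :: 'a \<Rightarrow>\<^sub>L real. \<forall>x\<in>K. \<bar>blinfun_apply f x\<bar> \<le> real n}" for n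
  have "closed (E n)" for n
  proof -
    have "E n = (\<Inter>x\<in>K. {f. \<bar>blinfun_apply f x\<bar> \<le> real n})" by (auto simp: E_def)
    then show ?thesis
      by (auto intro!: closed_INT closed_Collect_le continuous_intros)
  qed
  have "\<exists>n. interior (E n) \<noteq> {}"
  proof (rule ccontr)
    assume neg: "\<not> ?thesis"
    have "euclidean interior_of \<Union>(range E) = {}"
    proof (rule Baire_category_alt)
      fix T assume "T \<in> range E"
      then show "closedin euclidean T \<and> euclidean interior_of T = {}"
        using \<open>\<And>n. closed (E n)\<close> neg by (auto simp: interior_of_def interior_def)
    qed (auto simp: completely_metrizable_space_euclidean)
    then have "\<Union>(range E) \<noteq> UNIV" by auto
    then obtain f where f: "\<And>n. f \<notin> E n" by blast
    obtain B where "\<forall>x\<in>K. \<bar>blinfun_apply f x\<bar> \<le> B" using fK by blast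
    moreover obtain n where "B \<le> real n" using real_arch_simple by blast
    ultimately have "f \<in> E n" by (auto simp: E_def intro: order_trans)
    then show False using f by simp
  qed
  then obtain n f0 r where r: "0 < r" "cball f0 r \<subseteq> E n"
    by (metis ex_in_conv mem_interior_cball)
  \<comment> \<open>Let \<open>g\<close> be a norming functional for \<open>x\<close>. Both
    \<open>f0\<close> and \<open>f0 + r g\<close> lie in the ball and are bounded by
    \<open>n\<close> at \<open>x\<close>, so \<open>r g x\<close> is at most
    \<open>2 n\<close>.\<close>
  have "norm x \<le> 2 * real n / r" if x: "x \<in> K" for x
  proof -
    obtain f where f: "bounded_linear f" "\<And>z. f z \<le> norm z" "\<And>c. c \<in> {x} \<Longrightarrow> norm x \<le> f c"
      using Hahn_Banach_separation[of "{x}" "norm x"] by auto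
    define g where "g = Blinfun f"
    have g: "blinfun_apply g = f" using f(1) by (simp add: g_def bounded_linear_Blinfun_apply)
    have "norm g \<le> 1"
    proof (rule norm_blinfun_bound)
      fix z
      have "f (- z) = - f z" using linear_neg[OF bounded_linear.linear[OF f(1)]] .
      then show "norm (blinfun_apply g z) \<le> 1 * norm z"
        using f(2)[of z] f(2)[of "- z"] by (simp add: g abs_le_iff)
    qed simp
    then have "f0 + r *\<^sub>R g \<in> E n" "f0 \<in> E n" 
      using r by (auto intro!: subsetD[OF r(2)] simp: dist_norm mult_left_le)
    then have "\<bar>blinfun_apply f0 x + r * f x\<bar> \<le> real n" "\<bar>blinfun_apply f0 x\<bar> \<le> real n"
      using x by (auto simp: E_def blinfun.bilinear_simps g)
    then have "r * f x \<le> 2 * real n" by linarith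
    moreover have "norm x \<le> f x" using f(3) by simp
    ultimately have "r * norm x \<le> 2 * real n" using r(1) by (meson mult_left_mono order_trans less_imp_le)
    then show ?thesis using r(1) by (simp add: field_simps)
  qed
  then show ?thesis by (auto simp: bounded_iff)
qed

text \<open>The weak closures of the tails have the finite intersection property in
  \<open>K\<close>. A cluster point is enough later on: Mazur's lemma is applied to each tail
  separately.\<close>

lemma weakly_compact_cluster_point:
  fixes g :: "nat \<Rightarrow> 'a::real_normed_vector"
  assumes K: "compactin weak_top K" "closedin weak_top K" and g: "\<And>n. n \<in> M \<Longrightarrow> g n \<in> K"
    and M: "infinite M"
  shows "\<exists>y\<in>K. \<forall>l. y \<in> weak_top closure_of (g ` (M \<inter> {l..}))"
proof -
  define C where "C l = weak_top closure_of (g ` (M \<inter> {l..}))" for l :: nat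
  have "K \<inter> \<Inter>\<F> \<noteq> {}" if F: "finite \<F>" "\<F> \<subseteq> range C" for \<F>
  proof -
    obtain L where L: "finite L" "\<F> = C ` L" using finite_subset_image[OF F] by blast
    obtain B where B: "\<forall>l\<in>L. l \<le> B" using L(1) by (meson finite_nat_set_iff_bounded_le)
    obtain n where n: "n \<in> M" "B \<le> n" using M by (meson infinite_nat_iff_unbounded_le)
    have "g n \<in> C l" if "l \<in> L" for l
      unfolding C_def using n B that
      by (intro subsetD[OF closure_of_subset]) auto
    then have "g n \<in> K \<inter> \<Inter>\<F>" using g[OF n(1)] L(2) by blast
    then show ?thesis by blast
  qed
  moreover have "\<forall>D\<in>range C. closedin weak_top D" by (simp add: C_def)
  ultimately have "K \<inter> \<Inter>(range C) \<noteq> {}"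
    using K(1) unfolding compactin_fip by meson
  then obtain y where "y \<in> K" "\<And>l. y \<in> C l" by blast
  then show ?thesis unfolding C_def by blast
qed

section \<open>Plegma families and Ramsey stabilisation\<close>

text \<open>Values from \<open>n\<close> on are left free, so \<open>e(n := v)\<close> extends a
  family by one more position.\<close>

definition increasing_in :: "nat set \<Rightarrow> nat \<Rightarrow> (nat \<Rightarrow> nat) \<Rightarrow> bool" where
  "increasing_in Y n e \<longleftrightarrow> strict_mono_on {..<n} e \<and> e ` {..<n} \<subseteq> Y"

text \<open>A plegma family of length \<open>m\<close> is coded by the increasing enumeration \<open>e\<close> of its union: its members,
  numbered from \<open>0\<close>, are the values of \<open>e\<close> on the residue classes modulo \<open>m\<close>.\<close>

definition strand :: "nat \<Rightarrow> nat \<Rightarrow> (nat \<Rightarrow> nat) \<Rightarrow> nat \<Rightarrow> nat set" where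
  "strand k m e j = e ` {i. i < k * m \<and> i mod m = j}"

lemma increasing_in_mono: "increasing_in Y n e \<Longrightarrow> Y \<subseteq> Z \<Longrightarrow> increasing_in Z n e"
  by (auto simp: increasing_in_def)

lemma strict_mono_onI_Suc:
  fixes e :: "nat \<Rightarrow> nat"
  assumes "\<And>i. Suc i < n \<Longrightarrow> e i < e (Suc i)"
  shows "strict_mono_on {..<n} e"
proof (rule strict_mono_onI)
  fix i j assume "i \<in> {..<n}" "j \<in> {..<n}" "i < j"
  from \<open>i < j\<close> \<open>j \<in> {..<n}\<close> show "e i < e j"
  proof (induction j)
    case (Suc j)
    then show ?case using assms[of j] by (cases "i = j") auto
  qed simp
qed

lemma index_less:
  fixes i j k m :: nat
  assumes "i < k" "j < m"
  shows "i * m + j < k * m"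
proof -
  have "i * m + j < Suc i * m" using assms by simp
  also have "\<dots> \<le> k * m" using assms by (intro mult_le_mono1) simp
  finally show ?thesis .
qed

lemma strand_eq:
  assumes "j < m"
  shows "strand k m e j = (\<lambda>i. e (i * m + j)) ` {..<k}"
proof -
  have "{i. i < k * m \<and> i mod m = j} = (\<lambda>i. i * m + j) ` {..<k}"
  proof (intro equalityI subsetI)
    fix i assume "i \<in> {i. i < k * m \<and> i mod m = j}"
    then have "i = (i div m) * m + j" "i div m < k"
      using assms by (auto simp: less_mult_imp_div_less)
    then show "i \<in> (\<lambda>i. i * m + j) ` {..<k}" by blast
  next
    fix i assume "i \<in> (\<lambda>i. i * m + j) ` {..<k}"
    then show "i \<in> {i. i < k * m \<and> i mod m = j}"
      using assms index_less by auto
  qed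
  then show ?thesis unfolding strand_def by (simp add: image_image)
qed

lemma sorted_list_of_set_strict_mono_image:
  assumes "strict_mono_on {..<n::nat} (e :: nat \<Rightarrow> nat)"
  shows "sorted_list_of_set (e ` {..<n}) = map e [0..<n]"
proof -
  have "sorted_wrt (<) (map e [0..<n])"
    using assms by (auto simp: sorted_wrt_iff_nth_less strict_mono_on_def)
  then have "sorted_list_of_set (set (map e [0..<n])) = map e [0..<n]"
    by (intro sorted_list_of_set.idem_if_sorted_distinct)
       (auto simp: strict_sorted_iff)
  then show ?thesis by (simp add: lessThan_atLeast0)
qed

lemma strand_strict_mono:
  assumes "increasing_in Y (k * m) e" "j < m"
  shows "strict_mono_on {..<k} (\<lambda>i. e (i * m + j))"
proof (rule strict_mono_onI)
  fix a b assume ab: "a \<in> {..<k}" "b \<in> {..<k}" "a < b"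
  then have "a * m + j < b * m + j" using assms(2) by simp
  moreover have "a * m + j < k * m" "b * m + j < k * m" using ab assms(2) index_less by auto
  ultimately show "e (a * m + j) < e (b * m + j)"
    using assms(1) by (auto simp: increasing_in_def strict_mono_on_def)
qed

lemma strand_in_ksubsets:
  assumes "increasing_in Y (k * m) e" "j < m"
  shows "strand k m e j \<in> ksubsets Y k"
proof -
  have "card (strand k m e j) = k"
    unfolding strand_eq[OF assms(2)]
    using strict_mono_on_imp_inj_on[OF strand_strict_mono[OF assms]] by (simp add: card_image)
  moreover have "strand k m e j \<subseteq> Y"
    using assms(1) by (auto simp: strand_def increasing_in_def)
  moreover have "finite (strand k m e j)" by (simp add: strand_eq[OF assms(2)])
  ultimately show ?thesis by (simp add: ksubsets_def)
qed

lemma fel_strand: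
  assumes "increasing_in Y (k * m) e" "j < m" "1 \<le> i" "i \<le> k"
  shows "fel (strand k m e j) i = e ((i - 1) * m + j)"
proof -
  have "sorted_list_of_set (strand k m e j) = map (\<lambda>i. e (i * m + j)) [0..<k]"
    unfolding strand_eq[OF assms(2)]
    by (rule sorted_list_of_set_strict_mono_image[OF strand_strict_mono[OF assms(1,2)]])
  moreover have "i - 1 < k" using assms(3,4) by simp
  ultimately show ?thesis by (simp add: fel_def)
qed

text \<open>Index \<open>i * m + j\<close> carries element number \<open>i + 1\<close> of member
  number \<open>j + 1\<close>. Consecutive indices run through one row of this array and then pass
  to the next, so both plegma inequalities are instances of the monotonicity of
  \<open>e\<close>.\<close>

lemma plegma_strand:
  assumes e: "increasing_in Y (k * m) e" and m: "1 \<le> m"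
  shows "plegma Y k m (\<lambda>j. strand k m e (j - 1))"
  unfolding plegma_def
proof (intro conjI ballI)
  fix j assume "j \<in> {1..m}"
  then show "strand k m e (j - 1) \<in> ksubsets Y k"
    using strand_in_ksubsets[OF e] m by auto
next
  have less: "e a < e b" if "a < b" "b < k * m" for a b
    using e that by (auto simp: increasing_in_def strict_mono_on_def)
  {
    fix i j assume ij: "i \<in> {1..k}" "j \<in> {1..<m}"
    have "e ((i - 1) * m + (j - 1)) < e ((i - 1) * m + j)"
      using ij index_less[of "i - 1" k j m] by (intro less) auto
    then show "fel (strand k m e (j - 1)) i < fel (strand k m e (Suc j - 1)) i"
      using ij fel_strand[OF e, of "j - 1" i] fel_strand[OF e, of j i] by fastforce
  next
    fix i assume i: "i \<in> {1..<k}"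
    have "(i - 1) * m + (m - 1) < i * m + 0"
      using index_less[of "i - 1" i "m - 1" m] i m by simp
    moreover have "i * m + 0 < k * m" using i m by (intro index_less) auto
    ultimately have "e ((i - 1) * m + (m - 1)) < e (i * m + 0)" by (rule less)
    then show "fel (strand k m e (m - 1)) i < fel (strand k m e (1 - 1)) (Suc i)"
      using i m fel_strand[OF e, of "m - 1" i] fel_strand[OF e, of 0 "Suc i"] by simp
  }
qed

lemma ksubset_eq_fel_image:
  assumes "s \<in> ksubsets Y k"
  shows "s = (\<lambda>i. fel s (Suc i)) ` {..<k}"
proof -
  have s: "finite s" "card s = k" using assms by (auto simp: ksubsets_def)
  then have "s = set (sorted_list_of_set s)" by simp
  also have "\<dots> = (\<lambda>i. sorted_list_of_set s ! i) ` {..<k}"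
    using s by (auto simp: set_conv_nth)
  finally show ?thesis by (simp add: fel_def)
qed

text \<open>Reading the array row by row, a step from \<open>n\<close> to \<open>Suc n\<close> stays
  in a row, which is the first plegma inequality, or passes from the last member to the first one in
  the next row, which is the second.\<close>

lemma plegma_imp_strand:
  assumes pl: "plegma Y k m ss" and m: "1 \<le> m" and k: "1 \<le> k"
  obtains e where "increasing_in Y (k * m) e" "\<And>j. j < m \<Longrightarrow> ss (Suc j) = strand k m e j"
    "e 0 = fel (ss 1) 1"
proof -
  define e where "e n = fel (ss (Suc (n mod m))) (Suc (n div m))" for n
  have e: "e (i * m + j) = fel (ss (Suc j)) (Suc i)" if "j < m" for i j
    using that by (simp add: e_def)
  have ks: "ss (Suc j) \<in> ksubsets Y k" if "j < m" for j
    using pl that by (auto simp: plegma_def)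
  have col: "ss (Suc j) = strand k m e j" if "j < m" for j
    unfolding strand_eq[OF that] e[OF that] using ksubset_eq_fel_image[OF ks[OF that]] .
  have "strict_mono_on {..<k * m} e"
  proof (rule strict_mono_onI_Suc)
    fix n assume n: "Suc n < k * m"
    define i j where "i = n div m" and "j = n mod m"
    have nij: "n = i * m + j" "j < m" using m by (auto simp: i_def j_def)
    have "i < k" using n by (simp add: i_def less_mult_imp_div_less)
    show "e n < e (Suc n)"
    proof (cases "Suc j < m")
      case True
      have "fel (ss (Suc j)) (Suc i) < fel (ss (Suc (Suc j))) (Suc i)"
        using pl True \<open>i < k\<close> by (auto simp: plegma_def)
      then show ?thesis using e[of j i] e[of "Suc j" i] nij True by simp
    next
      case False
      then have j: "Suc j = m" using nij by simp
      have n': "Suc n = Suc i * m + 0" using nij j by simp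
      then have "Suc i < k" using n by (metis add_0_right mult_less_cancel2)
      moreover have "fel (ss m) (Suc i) < fel (ss 1) (Suc (Suc i))"
        using pl \<open>Suc i < k\<close> by (auto simp: plegma_def)
      ultimately show ?thesis
        unfolding n' using e[of j i] e[of 0 "Suc i"] nij(1) j m by simp
    qed
  qed
  moreover have "e ` {..<k * m} \<subseteq> Y"
  proof clarify
    fix n assume "n < k * m"
    then have "e n \<in> strand k m e (n mod m)" by (auto simp: strand_def)
    also have "\<dots> \<subseteq> Y" using ks[of "n mod m"] col[of "n mod m"] m by (auto simp: ksubsets_def)
    finally show "e n \<in> Y" .
  qed
  ultimately have "increasing_in Y (k * m) e" by (simp add: increasing_in_def)
  moreover have "e 0 = fel (ss 1) 1" using e[of 0 0] m by simp
  ultimately show thesis using col that by blast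
qed

lemma increasing_in_tail:
  assumes "increasing_in Y n e" "l \<le> e 0"
  shows "increasing_in (Y \<inter> {l..}) n e"
proof -
  have "l \<le> e i" if "i < n" for i
  proof (cases "i = 0")
    case False
    then have "e 0 < e i" using assms(1) that by (auto simp: increasing_in_def strict_mono_on_def)
    then show ?thesis using assms(2) by simp
  qed (use assms(2) in simp)
  then show ?thesis using assms(1) by (auto simp: increasing_in_def)
qed

text \<open>The wrap-around inequality has to be restored for the new last member, which lies below
  the old one row by row.\<close>

lemma plegma_initial:
  assumes "plegma Y k l ss" "1 \<le> m" "m \<le> l"
  shows "plegma Y k m ss"
proof -
  have "fel (ss m) i < fel (ss 1) (Suc i)" if i: "i \<in> {1..<k}" for i
  proof -
    have "fel (ss m) i \<le> fel (ss j) i" if "m \<le> j" "j \<le> l" for j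
      using that
    proof (induction j rule: dec_induct)
      case (step j)
      have "fel (ss j) i < fel (ss (Suc j)) i"
        using assms i step by (auto simp: plegma_def)
      then show ?case using step by simp
    qed simp
    then have "fel (ss m) i \<le> fel (ss l) i" using assms by simp
    also have "\<dots> < fel (ss 1) (Suc i)" using assms i by (simp add: plegma_def)
    finally show ?thesis .
  qed
  then show ?thesis using assms by (auto simp: plegma_def)
qed

text \<open>Here the wrap-around inequality meets a new first member, which lies above the old one
  row by row.\<close>

lemma plegma_final:
  assumes pl: "plegma Y k (p + m) ss" and "1 \<le> m"
  shows "plegma Y k m (\<lambda>j. ss (p + j))"
proof -
  have "fel (ss (p + m)) i < fel (ss (p + 1)) (Suc i)" if i: "i \<in> {1..<k}" for i
  proof -
    have "fel (ss 1) (Suc i) \<le> fel (ss (Suc j)) (Suc i)" if "Suc j \<le> p + m" for j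
      using that
    proof (induction j)
      case (Suc j)
      have "fel (ss (Suc j)) (Suc i) < fel (ss (Suc (Suc j))) (Suc i)"
        using pl i Suc by (auto simp: plegma_def)
      then show ?case using Suc by simp
    qed simp
    then have "fel (ss 1) (Suc i) \<le> fel (ss (p + 1)) (Suc i)" using assms by simp
    moreover have "fel (ss (p + m)) i < fel (ss 1) (Suc i)" using assms i by (simp add: plegma_def)
    ultimately show ?thesis by simp
  qed
  then show ?thesis using pl by (auto simp: plegma_def)
qed

section \<open>Stabilising norms along plegma families\<close>

text \<open>Coefficients are numbered from 0, to match \<open>strand\<close>; the 1-indexed
  coefficients of a spreading model enter as \<open>\<lambda>j. a (Suc j)\<close>.\<close>

definition plegma_comb ::
  "(nat set \<Rightarrow> 'a::real_normed_vector) \<Rightarrow> nat \<Rightarrow> nat \<Rightarrow> (nat \<Rightarrow> real) \<Rightarrow> (nat \<Rightarrow> nat) \<Rightarrow> 'a" where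
  "plegma_comb x k m a e = (\<Sum>j<m. a j *\<^sub>R x (strand k m e j))"

text \<open>Measures how much the norm still depends on the family, uniformly in the coefficients
  and without naming a limit. It passes to subsets of \<open>Y\<close>, as the diagonal argument
  requires.\<close>

definition osc_le ::
  "(nat set \<Rightarrow> 'a::real_normed_vector) \<Rightarrow> nat \<Rightarrow> nat \<Rightarrow> real \<Rightarrow> 'a \<Rightarrow> nat set \<Rightarrow> bool" where
  "osc_le x k m \<epsilon> z Y \<longleftrightarrow>
     (\<forall>a e e'. (\<forall>j<m. \<bar>a j\<bar> \<le> 1) \<and> increasing_in Y (k * m) e \<and> increasing_in Y (k * m) e' \<longrightarrow>
        \<bar>norm (plegma_comb x k m a e - z) - norm (plegma_comb x k m a e' - z)\<bar> \<le> \<epsilon>)"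

lemma osc_le_subset: "osc_le x k m \<epsilon> z Y \<Longrightarrow> Y' \<subseteq> Y \<Longrightarrow> osc_le x k m \<epsilon> z Y'"
  unfolding osc_le_def using increasing_in_mono by meson

lemma ksubsets_bound_nonneg:
  assumes "\<And>s. s \<in> ksubsets UNIV k \<Longrightarrow> norm (x s) \<le> K"
  shows "0 \<le> K"
proof -
  have "norm (x {..<k}) \<le> K" by (rule assms) (simp add: ksubsets_def)
  then show ?thesis using norm_ge_zero order_trans by blast
qed

lemma norm_plegma_comb_le:
  assumes K: "\<And>s. s \<in> ksubsets UNIV k \<Longrightarrow> norm (x s) \<le> K"
    and e: "increasing_in Y (k * m) e"
  shows "norm (plegma_comb x k m a e) \<le> (\<Sum>j<m. \<bar>a j\<bar>) * K"
proof -
  have "norm (plegma_comb x k m a e) \<le> (\<Sum>j<m. \<bar>a j\<bar> * K)"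
    unfolding plegma_comb_def
  proof (rule sum_norm_le)
    fix j assume "j \<in> {..<m}"
    then have "norm (x (strand k m e j)) \<le> K"
      using strand_in_ksubsets[OF increasing_in_mono[OF e subset_UNIV]] by (intro K) auto
    then show "norm (a j *\<^sub>R x (strand k m e j)) \<le> \<bar>a j\<bar> * K" by (simp add: mult_left_mono)
  qed
  then show ?thesis by (simp add: sum_distrib_right)
qed

lemma plegma_comb_diff:
  "plegma_comb x k m a e - plegma_comb x k m b e = plegma_comb x k m (\<lambda>j. a j - b j) e"
  by (simp add: plegma_comb_def scaleR_left_diff_distrib sum_subtractf)

lemma plegma_comb_cong:
  assumes "\<And>i. i < k * m \<Longrightarrow> e i = e' i"
  shows "plegma_comb x k m a e = plegma_comb x k m a e'"
proof -
  have "strand k m e j = strand k m e' j" for j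
    unfolding strand_def using assms by (intro image_cong) auto
  then show ?thesis by (simp add: plegma_comb_def)
qed

lemma Ramsey_finite_range:
  fixes f :: "nat set \<Rightarrow> 'c"
  assumes "infinite Y" "finite C" "\<And>u. u \<subseteq> Y \<Longrightarrow> finite u \<Longrightarrow> card u = r \<Longrightarrow> f u \<in> C"
  obtains Y' c where "Y' \<subseteq> Y" "infinite Y'" "\<And>u. u \<subseteq> Y' \<Longrightarrow> finite u \<Longrightarrow> card u = r \<Longrightarrow> f u = c"
proof -
  obtain h where h: "bij_betw h C {0..<card C}" using ex_bij_betw_finite_nat[OF assms(2)] by blast
  have "\<forall>u. u \<subseteq> Y \<and> finite u \<and> card u = r \<longrightarrow> h (f u) < card C"
    using assms(3) bij_betwE[OF h] by auto
  then obtain Y' t where Y': "Y' \<subseteq> Y" "infinite Y'"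
    and t: "\<forall>u. u \<subseteq> Y' \<and> finite u \<and> card u = r \<longrightarrow> h (f u) = t"
    using Ramsey[OF assms(1), of r "\<lambda>u. h (f u)" "card C"] by blast
  have "f u = inv_into C h t" if "u \<subseteq> Y'" "finite u" "card u = r" for u
  proof -
    have "f u \<in> C" using that Y'(1) by (intro assms(3)) auto
    then show ?thesis using t that h by (metis bij_betw_inv_into_left)
  qed
  then show thesis using that Y' by blast
qed

text \<open>An increasing \<open>e\<close> is recovered from its range, so Ramsey's theorem applies to the colouring
  that records, for each coefficient vector on a finite grid, the norm up to \<open>1 / R\<close>.\<close>

lemma Ramsey_osc_le:
  fixes x :: "nat set \<Rightarrow> 'a::real_normed_vector"
  assumes K: "\<And>s. s \<in> ksubsets UNIV k \<Longrightarrow> norm (x s) \<le> K"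
    and Y: "infinite Y" and \<epsilon>: "0 < \<epsilon>"
  shows "\<exists>Y'\<subseteq>Y. infinite Y' \<and> osc_le x k m \<epsilon> z Y'"
proof -
  have K0: "0 \<le> K" using K by (rule ksubsets_bound_nonneg)
  \<comment> \<open>The final error is \<open>(1 + 2 m K) / R\<close>: \<open>1 / R\<close> from
    rounding the norms, and \<open>m K / R\<close> for each of the two families from rounding the
    coefficients to the grid.\<close>
  obtain R :: nat where R: "(1 + 2 * real m * K) / \<epsilon> < real R" using reals_Archimedean2 by blast
  have "0 \<le> (1 + 2 * real m * K) / \<epsilon>" using K0 \<epsilon> by simp
  then have R0: "0 < real R" using R by linarith
  have R\<epsilon>: "(1 + 2 * real m * K) / R \<le> \<epsilon>"
    using R R0 \<epsilon> by (simp add: field_simps)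
  define G where "G = (\<Pi>\<^sub>E j\<in>{..<m}. {- int R..int R})"
  \<comment> \<open>\<open>B\<close> bounds the rounded norms, so the colours, being functions on
    the finite grid \<open>G\<close>, form a finite set.\<close>
  define B where "B = \<lfloor>R * (real m * K + norm z)\<rfloor>"
  define v where "v g e = \<lfloor>R * norm (plegma_comb x k m (\<lambda>j. real_of_int (g j) / R) e - z)\<rfloor>" for g e
  define f where "f u = (\<lambda>g\<in>G. v g (\<lambda>n. sorted_list_of_set u ! n))" for u
  have G: "finite G" unfolding G_def by (intro finite_PiE) auto
  have fe: "f (e ` {..<k * m}) = (\<lambda>g\<in>G. v g e)" if "increasing_in W (k * m) e" for W e
  proof -
    have "sorted_list_of_set (e ` {..<k * m}) = map e [0..<k * m]"
      using that by (intro sorted_list_of_set_strict_mono_image) (simp add: increasing_in_def)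
    then have "plegma_comb x k m a (\<lambda>n. sorted_list_of_set (e ` {..<k * m}) ! n)
        = plegma_comb x k m a e" for a
      by (intro plegma_comb_cong) simp
    then have "v g (\<lambda>n. sorted_list_of_set (e ` {..<k * m}) ! n) = v g e" for g
      by (simp add: v_def)
    then show ?thesis by (simp add: f_def)
  qed
  have vB: "v g e \<in> {0..B}" if "g \<in> G" "increasing_in W (k * m) e" for g e W
  proof -
    have g: "\<bar>real_of_int (g j) / R\<bar> \<le> 1" if "j < m" for j
    proof -
      have "g j \<in> {- int R..int R}" using PiE_mem[OF \<open>g \<in> G\<close>[unfolded G_def]] that by blast
      then have "\<bar>g j\<bar> \<le> int R" by auto
      then have "\<bar>real_of_int (g j)\<bar> \<le> R" by linarith
      then show ?thesis using R0 by (simp add: field_simps)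
    qed
    have "norm (plegma_comb x k m (\<lambda>j. real_of_int (g j) / R) e)
        \<le> (\<Sum>j<m. \<bar>real_of_int (g j) / R\<bar>) * K"
      using K that(2) by (rule norm_plegma_comb_le)
    also have "\<dots> \<le> real m * K"
      using sum_bounded_above[of "{..<m}" "\<lambda>j. \<bar>real_of_int (g j) / R\<bar>" 1] g K0
      by (intro mult_right_mono) auto
    finally have "norm (plegma_comb x k m (\<lambda>j. real_of_int (g j) / R) e - z) \<le> real m * K + norm z"
      using norm_triangle_ineq4 order_trans add_right_mono by metis
    then show ?thesis
      unfolding v_def B_def using R0 by (auto intro!: floor_mono mult_left_mono)
  qed
  have "f u \<in> (\<Pi>\<^sub>E g\<in>G. {0..B})" if u: "u \<subseteq> Y" "finite u" "card u = k * m" for u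
  proof -
    let ?e = "\<lambda>n. sorted_list_of_set u ! n"
    have "strict_mono_on {..<k * m} ?e"
      using u by (intro strict_mono_onI) (simp add: sorted_wrt_nth_less[OF strict_sorted_list_of_set])
    then have "increasing_in UNIV (k * m) ?e" by (simp add: increasing_in_def)
    then show ?thesis using vB by (auto simp: f_def)
  qed
  then obtain Y' c where Y': "Y' \<subseteq> Y" "infinite Y'"
    and c: "\<And>u. u \<subseteq> Y' \<Longrightarrow> finite u \<Longrightarrow> card u = k * m \<Longrightarrow> f u = c"
    using Ramsey_finite_range[OF Y, of "\<Pi>\<^sub>E g\<in>G. {0..B}" "k * m" f] G
    by (metis finite_PiE finite_atLeastAtMost_int)
  have vc: "v g e = c g" if "increasing_in Y' (k * m) e" "g \<in> G" for e g
  proof -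
    have "card (e ` {..<k * m}) = k * m"
      using that(1) by (simp add: increasing_in_def card_image strict_mono_on_imp_inj_on)
    then have "f (e ` {..<k * m}) = c" using that(1) by (intro c) (auto simp: increasing_in_def)
    then show ?thesis using fe[OF that(1)] that(2) by (metis restrict_apply')
  qed
  have "osc_le x k m \<epsilon> z Y'"
    unfolding osc_le_def
  proof clarify
    fix a :: "nat \<Rightarrow> real" and e e' assume a: "\<forall>j<m. \<bar>a j\<bar> \<le> 1"
      and e: "increasing_in Y' (k * m) e" and e': "increasing_in Y' (k * m) e'"
    define g where "g = (\<lambda>j\<in>{..<m}. \<lfloor>R * a j\<rfloor>)"
    define b where "b j = real_of_int (g j) / R" for j
    have "g \<in> G"
    proof -
      have "- int R \<le> \<lfloor>R * a j\<rfloor> \<and> \<lfloor>R * a j\<rfloor> \<le> int R" if "j < m" for j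
      proof -
        have "- real R \<le> R * a j" "R * a j \<le> R"
          using a[rule_format, OF that] R0
          by (auto simp: abs_le_iff mult_left_le intro: order_trans[OF _ mult_left_mono[of "- 1"]])
        then show ?thesis by linarith
      qed
      then show ?thesis by (auto simp: G_def g_def)
    qed
    have ab: "\<bar>a j - b j\<bar> \<le> 1 / R" if "j < m" for j
    proof -
      have "\<bar>R * a j - \<lfloor>R * a j\<rfloor>\<bar> \<le> 1" by linarith
      moreover have "a j - b j = (R * a j - \<lfloor>R * a j\<rfloor>) / R"
        using R0 that by (simp add: b_def g_def field_simps)
      ultimately show ?thesis using R0 by (simp add: divide_right_mono)
    qed
    have near: "\<bar>norm (plegma_comb x k m a d - z) - norm (plegma_comb x k m b d - z)\<bar> \<le> real m * K / R"
      if "increasing_in Y' (k * m) d" for d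
    proof -
      have "\<bar>norm (plegma_comb x k m a d - z) - norm (plegma_comb x k m b d - z)\<bar>
          \<le> norm ((plegma_comb x k m a d - z) - (plegma_comb x k m b d - z))"
        by (rule norm_triangle_ineq3)
      also have "\<dots> = norm (plegma_comb x k m (\<lambda>j. a j - b j) d)"
        by (simp add: plegma_comb_diff)
      also have "\<dots> \<le> (\<Sum>j<m. \<bar>a j - b j\<bar>) * K"
        using K that by (rule norm_plegma_comb_le)
      also have "\<dots> \<le> (real m * (1 / R)) * K"
        using sum_bounded_above[of "{..<m}" "\<lambda>j. \<bar>a j - b j\<bar>" "1 / R"] ab K0
        by (intro mult_right_mono) auto
      finally show ?thesis by simp
    qed
    have fl: "\<bar>norm (plegma_comb x k m b e - z) - norm (plegma_comb x k m b e' - z)\<bar> \<le> 1 / R"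
    proof -
      have "v g e = v g e'" using vc[OF e \<open>g \<in> G\<close>] vc[OF e' \<open>g \<in> G\<close>] by simp
      then have "\<bar>R * norm (plegma_comb x k m b e - z) - R * norm (plegma_comb x k m b e' - z)\<bar> \<le> 1"
        unfolding v_def b_def[symmetric] by linarith
      then have "R * \<bar>norm (plegma_comb x k m b e - z) - norm (plegma_comb x k m b e' - z)\<bar> \<le> 1"
        using R0 by (simp add: right_diff_distrib[symmetric] abs_mult)
      then show ?thesis using R0 by (simp add: field_simps)
    qed
    have "(1 + 2 * real m * K) / R = 1 / R + 2 * (real m * K / R)" by (simp add: add_divide_distrib)
    then show "\<bar>norm (plegma_comb x k m a e - z) - norm (plegma_comb x k m a e' - z)\<bar> \<le> \<epsilon>"
      using near[OF e] near[OF e'] fl R\<epsilon> by linarith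
  qed
  then show ?thesis using Y' by blast
qed

lemma finite_conj_infinite_subset:
  fixes \<phi> :: "'i \<Rightarrow> nat set \<Rightarrow> bool"
  assumes "finite J"
    and dense: "\<And>j Y. j \<in> J \<Longrightarrow> infinite Y \<Longrightarrow> \<exists>Y'\<subseteq>Y. infinite Y' \<and> \<phi> j Y'"
    and hered: "\<And>j Y Y'. \<phi> j Y \<Longrightarrow> Y' \<subseteq> Y \<Longrightarrow> \<phi> j Y'"
    and "infinite Y"
  shows "\<exists>Y'\<subseteq>Y. infinite Y' \<and> (\<forall>j\<in>J. \<phi> j Y')"
  using assms(1) dense
proof (induction J rule: finite_induct)
  case empty
  then show ?case using assms(4) by auto
next
  case (insert i J)
  then obtain Y1 where Y1: "Y1 \<subseteq> Y" "infinite Y1" "\<forall>j\<in>J. \<phi> j Y1" by auto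
  moreover obtain Y2 where "Y2 \<subseteq> Y1" "infinite Y2" "\<phi> i Y2" using insert.prems[of i Y1] Y1 by auto
  ultimately show ?case using hered by (intro exI[of _ Y2]) blast
qed

text \<open>Choose nested sets, the \<open>n\<close>-th satisfying \<open>\<phi> n\<close>, and
  collect their minima. Each set omits the minimum of its predecessor, so the minima increase, and a
  tail of \<open>M\<close> lies in the \<open>n\<close>-th set; heredity does the rest.\<close>

lemma diagonal_infinite_subset:
  fixes \<phi> :: "nat \<Rightarrow> nat set \<Rightarrow> bool"
  assumes dense: "\<And>n Y. infinite Y \<Longrightarrow> \<exists>Y'\<subseteq>Y. infinite Y' \<and> \<phi> n Y'"
    and hered: "\<And>n Y Y'. \<phi> n Y \<Longrightarrow> Y' \<subseteq> Y \<Longrightarrow> \<phi> n Y'"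
  obtains M where "infinite M" "\<And>n. \<phi> n (M \<inter> {enumerate M n..})"
proof -
  have "\<exists>F. \<forall>n. (infinite (F n) \<and> \<phi> n (F n)) \<and> F (Suc n) \<subseteq> F n \<inter> {Inf (F n)<..}"
  proof (rule dependent_nat_choice)
    show "\<exists>Y. infinite Y \<and> \<phi> 0 Y" using dense[of UNIV 0] by auto
    fix Y n assume Y: "infinite Y \<and> \<phi> n Y"
    have "infinite (Y \<inter> {Inf Y<..})"
    proof
      assume "finite (Y \<inter> {Inf Y<..})"
      then have "finite (Y \<inter> {Inf Y<..} \<union> {..Inf Y})" by simp
      moreover have "Y \<subseteq> Y \<inter> {Inf Y<..} \<union> {..Inf Y}" by auto
      ultimately show False using Y finite_subset by blast
    qed
    then show "\<exists>Y'. (infinite Y' \<and> \<phi> (Suc n) Y') \<and> Y' \<subseteq> Y \<inter> {Inf Y<..}"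
      using dense by blast
  qed
  then obtain F where F: "\<And>n. infinite (F n)" "\<And>n. \<phi> n (F n)"
    "\<And>n. F (Suc n) \<subseteq> F n \<inter> {Inf (F n)<..}" by blast
  define \<mu> where "\<mu> n = Inf (F n)" for n
  have \<mu>F: "\<mu> n \<in> F n" for n unfolding \<mu>_def using F(1)[of n] by (intro Inf_nat_def1) auto
  have "F (Suc n) \<subseteq> F n" for n using F(3)[of n] by blast
  then have Fanti: "F j \<subseteq> F i" if "i \<le> j" for i j
    by (rule lift_Suc_antimono_le) (rule that)
  have "\<mu> n < \<mu> (Suc n)" for n using \<mu>F[of "Suc n"] F(3)[of n] by (auto simp: \<mu>_def)
  then have \<mu>: "strict_mono \<mu>" by (simp add: strict_mono_Suc_iff)
  define M where "M = range \<mu>"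
  have M: "infinite M" unfolding M_def using \<mu> by (simp add: range_inj_infinite strict_mono_imp_inj_on)
  \<comment> \<open>The position of the \<open>n\<close>-th element of \<open>M\<close> in the
    sequence \<open>\<mu>\<close>; it is at least \<open>n\<close>, which puts the tail of
    \<open>M\<close> inside \<open>F n\<close>.\<close>
  define i where "i n = inv \<mu> (enumerate M n)" for n
  have i: "\<mu> (i n) = enumerate M n" for n
    unfolding i_def using enumerate_in_set[OF M, of n] by (intro f_inv_into_f) (simp add: M_def)
  have "i n < i (Suc n)" for n
    using enumerate_step[OF M, of n] i strict_mono_less[OF \<mu>] by metis
  then have "strict_mono i" by (simp add: strict_mono_Suc_iff)
  then have ge: "\<mu> n \<le> enumerate M n" for n
    using strict_mono_imp_increasing[of i n] i[of n] strict_mono_less_eq[OF \<mu>] by metis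
  have "M \<inter> {enumerate M n..} \<subseteq> F n" for n
  proof
    fix v assume "v \<in> M \<inter> {enumerate M n..}"
    then obtain j where j: "v = \<mu> j" "\<mu> n \<le> \<mu> j" using ge[of n] by (force simp: M_def)
    then have "n \<le> j" using strict_mono_less_eq[OF \<mu>] by blast
    then show "v \<in> F n" using Fanti \<mu>F j by blast
  qed
  then show thesis using that[OF M] F(2) hered by blast
qed

text \<open>Stage \<open>n\<close> asks only for lengths up to \<open>Suc n\<close>, finitely many
  centres and accuracy \<open>1 / Suc n\<close>, so finitely many uses of Ramsey's theorem settle
  it. The centre \<open>0\<close> occurs at every stage because the spreading model needs an
  explicit null sequence of errors.\<close>

lemma ex_asymptotic_subset:
  fixes x :: "nat set \<Rightarrow> 'a::real_normed_vector" and zz :: "nat \<Rightarrow> 'a"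
  assumes K: "\<And>s. s \<in> ksubsets UNIV k \<Longrightarrow> norm (x s) \<le> K"
  obtains M where "infinite M"
    "\<And>n m z. m \<le> Suc n \<Longrightarrow> z \<in> insert 0 (zz ` {..n}) \<Longrightarrow>
       osc_le x k m (1 / Suc n) z (M \<inter> {enumerate M n..})"
proof -
  define \<phi> where "\<phi> n Y \<longleftrightarrow> (\<forall>j\<in>{..Suc n} \<times> insert 0 (zz ` {..n}).
    osc_le x k (fst j) (1 / Suc n) (snd j) Y)" for n Y
  have "\<exists>Y'\<subseteq>Y. infinite Y' \<and> \<phi> n Y'" if "infinite Y" for n Y
    unfolding \<phi>_def
  proof (rule finite_conj_infinite_subset[OF _ _ _ that])
    show "\<exists>Y'\<subseteq>W. infinite Y' \<and> osc_le x k (fst j) (1 / Suc n) (snd j) Y'"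
      if "infinite W" for W and j :: "nat \<times> 'a"
      by (rule Ramsey_osc_le[OF K that]) simp_all
  qed (simp, rule osc_le_subset)
  moreover have "\<phi> n Y'" if "\<phi> n Y" "Y' \<subseteq> Y" for n Y Y'
    using that(1) unfolding \<phi>_def by (intro ballI osc_le_subset[OF _ that(2)]) (rule bspec)
  ultimately obtain M where M: "infinite M" "\<And>n. \<phi> n (M \<inter> {enumerate M n..})"
    using diagonal_infinite_subset[of \<phi>] by metis
  have "osc_le x k m (1 / Suc n) z (M \<inter> {enumerate M n..})"
    if "m \<le> Suc n" "z \<in> insert 0 (zz ` {..n})" for n m z
    using M(2)[of n, unfolded \<phi>_def, THEN bspec, of "(m, z)"] that by simp
  then show thesis by (rule that[OF M(1)])
qed

text \<open>Rational combinations of an enumeration of \<open>S\<close> suffice; as lists over a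
  countable type they are countably many.\<close>

lemma span_separable:
  fixes S :: "'a::real_normed_vector set"
  assumes "countable S"
  obtains zz :: "nat \<Rightarrow> 'a" where "span S \<subseteq> closure (range zz)"
proof -
  define w where "w L = (\<Sum>(q, i)\<leftarrow>L. real_of_rat q *\<^sub>R from_nat_into S i)" for L :: "(rat \<times> nat) list"
  have "\<forall>\<epsilon>>0. \<exists>L. norm (w L - v) < \<epsilon>" if "v \<in> span S" for v
    using that
  proof (induction rule: span_induct_alt)
    case base
    show ?case by (auto intro!: exI[of _ "[]"] simp: w_def)
  next
    case (step c u v)
    show ?case
    proof (intro allI impI)
      fix \<epsilon> :: real assume \<epsilon>: "0 < \<epsilon>"
      obtain L where L: "norm (w L - v) < \<epsilon> / 2" using step.IH \<epsilon> half_gt_zero by blast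
      obtain i where i: "from_nat_into S i = u" using from_nat_into_surj[OF assms step.hyps] by blast
      \<comment> \<open>The summand \<open>1\<close> avoids a division by zero when
        \<open>u = 0\<close>.\<close>
      define \<eta> where "\<eta> = \<epsilon> / (2 * (norm u + 1))"
      have "0 < \<eta>" using \<epsilon> norm_ge_zero[of u] by (simp add: \<eta>_def add_nonneg_pos)
      then obtain q where q: "c < real_of_rat q" "real_of_rat q < c + \<eta>"
        using of_rat_dense[of c "c + \<eta>"] by auto
      have "norm (w ((q, i) # L) - (c *\<^sub>R u + v)) = norm ((real_of_rat q - c) *\<^sub>R u + (w L - v))"
        by (simp add: w_def i algebra_simps)
      also have "\<dots> \<le> \<bar>real_of_rat q - c\<bar> * norm u + norm (w L - v)"
        by (metis norm_triangle_ineq norm_scaleR)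
      also have "\<bar>real_of_rat q - c\<bar> * norm u \<le> \<eta> * (norm u + 1)"
        using q by (intro mult_mono) auto
      also have "\<eta> * (norm u + 1) = \<epsilon> / 2"
        using norm_ge_zero[of u] by (simp add: \<eta>_def field_simps add_nonneg_eq_0_iff)
      finally have "norm (w ((q, i) # L) - (c *\<^sub>R u + v)) < \<epsilon>" using L by linarith
      then show "\<exists>L. norm (w L - (c *\<^sub>R u + v)) < \<epsilon>" by blast
    qed
  qed
  moreover have "range w = range (\<lambda>n. w (from_nat n))"
    by (metis (no_types, lifting) from_nat_to_nat rangeI subsetI image_subset_iff subset_antisym)
  ultimately have "v \<in> closure (range (\<lambda>n. w (from_nat n)))" if "v \<in> span S" for v
    unfolding closure_approachable dist_norm using that by (metis rangeI)
  then have "span S \<subseteq> closure (range (\<lambda>n. w (from_nat n)))" by blast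
  then show thesis by (rule that)
qed

section \<open>Cesaro means\<close>

text \<open>The shifts act on indices, before \<open>enumerate L\<close> is applied, so the spacing
  concerns \<open>t\<close> and not \<open>L\<close>. Index \<open>i * p + j\<close> goes to
  \<open>\<tau> ! i + j\<close>, and the gaps of \<open>t\<close> keep the last shift of one element
  below the next element.\<close>

lemma shifted_strands:
  assumes L: "infinite L" and t: "t \<in> ksubsets UNIV k" and p: "1 \<le> p"
    and gap: "\<And>a b. a \<in> t \<Longrightarrow> b \<in> t \<Longrightarrow> a < b \<Longrightarrow> a + p \<le> b"
    and l: "\<And>a. a \<in> t \<Longrightarrow> l \<le> a" and k: "1 \<le> k"
  obtains e where "increasing_in L (k * p) e" "l \<le> e 0"
    "\<And>j. j < p \<Longrightarrow> strand k p e j = enumerate L ` (\<lambda>a. a + j) ` t"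
proof -
  define \<tau> where "\<tau> = sorted_list_of_set t"
  have fin: "finite t" "card t = k" using t by (auto simp: ksubsets_def)
  have \<tau>t: "\<tau> ! i \<in> t" if "i < k" for i
    using that fin nth_mem[of i \<tau>] by (simp add: \<tau>_def)
  have \<tau>less: "\<tau> ! i < \<tau> ! j" if "i < j" "j < k" for i j
    unfolding \<tau>_def using that fin by (intro sorted_wrt_nth_less[OF strict_sorted_list_of_set]) auto
  have t\<tau>: "t = (\<lambda>i. \<tau> ! i) ` {..<k}"
    using ksubset_eq_fel_image[OF t] by (simp add: fel_def \<tau>_def)
  define e where "e q = enumerate L (\<tau> ! (q div p) + q mod p)" for q
  have "strict_mono_on {..<k * p} e"
  proof (rule strict_mono_onI)
    fix q r assume qr: "q \<in> {..<k * p}" "r \<in> {..<k * p}" "q < r"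
    have le: "q div p \<le> r div p" using qr by (simp add: div_le_mono)
    have rk: "r div p < k" using qr by (simp add: less_mult_imp_div_less)
    have "\<tau> ! (q div p) + q mod p < \<tau> ! (r div p) + r mod p"
    proof (cases "q div p = r div p")
      case True
      moreover have "q = q div p * p + q mod p" "r = r div p * p + r mod p" by simp_all
      ultimately have "q mod p < r mod p" using qr(3) by (metis nat_add_left_cancel_less)
      then show ?thesis using True by simp
    next
      case False
      then have "q div p < r div p" using le by simp
      then have "\<tau> ! (q div p) + p \<le> \<tau> ! (r div p)"
        using \<tau>less \<tau>t rk by (intro gap) auto
      moreover have "q mod p < p" using p by simp
      ultimately show ?thesis by linarith
    qed
    then show "e q < e r" unfolding e_def by (rule enumerate_mono[OF _ L])
  qed
  moreover have "e ` {..<k * p} \<subseteq> L" using enumerate_in_set[OF L] by (auto simp: e_def)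
  ultimately have "increasing_in L (k * p) e" by (simp add: increasing_in_def)
  moreover have "l \<le> e 0"
  proof -
    have "l \<le> \<tau> ! 0" using \<tau>t[of 0] k l by simp
    \<comment> \<open>\<open>enumerate L i\<close> is at least \<open>i\<close>, so a bound on
      indices bounds the elements.\<close>
    also have "\<dots> \<le> e 0" using le_enumerate[OF L, of "\<tau> ! 0"] by (simp add: e_def)
    finally show ?thesis .
  qed
  moreover have "strand k p e j = enumerate L ` (\<lambda>a. a + j) ` t" if "j < p" for j
  proof -
    have "e (i * p + j) = enumerate L (\<tau> ! i + j)" for i using that by (simp add: e_def)
    then show ?thesis unfolding strand_eq[OF that] t\<tau> by (simp add: image_image)
  qed
  ultimately show thesis by (rule that)
qed

lemma card_ksubsets: "card (ksubsets {..<n} k) = n choose k" and finite_ksubsets: "finite (ksubsets {..<n} k)"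
proof -
  have eq: "ksubsets {..<n} k = {s. s \<subseteq> {..<n} \<and> card s = k}"
    unfolding ksubsets_def using finite_subset[of _ "{..<n}"] by auto
  show "card (ksubsets {..<n} k) = n choose k" unfolding eq using n_subsets[of "{..<n}" k] by simp
  have "ksubsets {..<n} k \<subseteq> Pow {..<n}" unfolding eq by blast
  then show "finite (ksubsets {..<n} k)" by (rule finite_subset) simp
qed

text \<open>Each badly spaced \<open>t\<close> has an element \<open>b\<close> confined to a set
  \<open>D (t - {b})\<close> of at most \<open>l + p + k * p\<close> positions: below
  \<open>l\<close>, among the last \<open>p\<close> indices, or less than \<open>p\<close> above
  another element. So \<open>t\<close> arises by adding one of few points to a set of
  \<open>k - 1\<close> elements.\<close>

lemma card_badly_spaced_le:
  assumes "1 \<le> k"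
  shows "card {t \<in> ksubsets {..<n} k.
      \<not> (\<forall>a\<in>t. l \<le> a \<and> a + p \<le> n \<and> (\<forall>b\<in>t. a < b \<longrightarrow> a + p \<le> b))}
    \<le> (n choose (k - 1)) * (l + p + k * p)" (is "card ?B \<le> _")
proof -
  define D where "D s = {..<l} \<union> {n - p..<n} \<union> (\<Union>a\<in>s. {a..<a + p})" for s
  have finD: "finite (D s)" if "finite s" for s using that by (simp add: D_def)
  have "?B \<subseteq> (\<Union>s\<in>ksubsets {..<n} (k - 1). (\<lambda>b. insert b s) ` D s)"
  proof
    fix t assume t: "t \<in> ?B"
    then have fin: "finite t" "card t = k" "t \<subseteq> {..<n}" by (auto simp: ksubsets_def)
    obtain b where b: "b \<in> t" "b \<in> D (t - {b})"
    proof -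
      obtain a where "a \<in> t" "a < l \<or> n < a + p \<or> (\<exists>b\<in>t. a < b \<and> b < a + p)"
        using t by (auto simp: not_le)
      then consider "a < l" | "n < a + p" | b where "b \<in> t" "a < b" "b < a + p" by blast
      then show thesis
      proof cases
        case 1
        then show ?thesis using \<open>a \<in> t\<close> by (intro that[of a]) (auto simp: D_def)
      next
        case 2
        then show ?thesis using \<open>a \<in> t\<close> fin(3) by (intro that[of a]) (auto simp: D_def)
      next
        \<comment> \<open>The upper point of a close pair is removed, since \<open>D\<close> only
          looks above the remaining elements.\<close>
        case 3
        then show ?thesis using \<open>a \<in> t\<close> by (intro that[of b]) (auto simp: D_def)
      qed
    qed
    have "t - {b} \<in> ksubsets {..<n} (k - 1)" using fin b by (auto simp: ksubsets_def)
    moreover have "t \<in> (\<lambda>c. insert c (t - {b})) ` D (t - {b})" using b by auto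
    ultimately show "t \<in> (\<Union>s\<in>ksubsets {..<n} (k - 1). (\<lambda>b. insert b s) ` D s)" by blast
  qed
  then have "card ?B \<le> card (\<Union>s\<in>ksubsets {..<n} (k - 1). (\<lambda>b. insert b s) ` D s)"
    using finD by (intro card_mono finite_UN_I finite_ksubsets finite_imageI) (auto simp: ksubsets_def)
  also have "\<dots> \<le> (\<Sum>s\<in>ksubsets {..<n} (k - 1). card ((\<lambda>b. insert b s) ` D s))"
    by (rule card_UN_le[OF finite_ksubsets])
  also have "\<dots> \<le> (\<Sum>s\<in>ksubsets {..<n} (k - 1). l + p + k * p)"
  proof (rule sum_mono)
    fix s assume "s \<in> ksubsets {..<n} (k - 1)"
    then have s: "finite s" "card s = k - 1" by (auto simp: ksubsets_def)
    have "card ((\<lambda>b. insert b s) ` D s) \<le> card (D s)" by (rule card_image_le[OF finD[OF s(1)]])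
    also have "\<dots> \<le> card ({..<l} \<union> {n - p..<n}) + card (\<Union>a\<in>s. {a..<a + p})"
      unfolding D_def by (rule card_Un_le)
    also have "\<dots> \<le> (card {..<l} + card {n - p..<n}) + (\<Sum>a\<in>s. card {a..<a + p})"
      by (intro add_mono card_Un_le card_UN_le s)
    also have "\<dots> \<le> l + p + k * p"
    proof -
      have "(\<Sum>a\<in>s. card {a..<a + p}) \<le> k * p" using s by simp
      moreover have "card {n - p..<n} \<le> p" "card {..<l} = l" by simp_all
      ultimately show ?thesis by linarith
    qed
    finally show "card ((\<lambda>b. insert b s) ` D s) \<le> l + p + k * p" .
  qed
  also have "\<dots> = (n choose (k - 1)) * (l + p + k * p)" by (simp add: card_ksubsets)
  finally show ?thesis .
qed

text \<open>The quotient of the two binomial coefficients is \<open>k / (n - (k - 1))\<close>, which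
  tends to zero.\<close>

lemma binomial_pred_negligible:
  fixes \<epsilon> C :: real
  assumes "1 \<le> k" "0 < \<epsilon>" "0 \<le> C"
  shows "eventually (\<lambda>n. C * (n choose (k - 1)) \<le> \<epsilon> * (n choose k)) sequentially"
proof -
  obtain N :: nat where N: "C * k / \<epsilon> \<le> N" using real_arch_simple by blast
  have "C * (n choose (k - 1)) \<le> \<epsilon> * (n choose k)" if n: "N + k \<le> n" for n
  proof -
    have "(n - (k - 1)) * (n choose (k - 1)) = k * (n choose k)"
      using binomial_absorb_comp[of n "k - 1"] times_binomial_minus1_eq[of k n] assms(1) by simp
    then have "real (n - (k - 1)) * (n choose (k - 1)) = k * (n choose k)"
      by (metis of_nat_mult)
    moreover have "C * k \<le> \<epsilon> * real (n - (k - 1))"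
    proof -
      have "C * k \<le> \<epsilon> * N" using N assms(2) by (simp add: field_simps)
      also have "\<dots> \<le> \<epsilon> * real (n - (k - 1))" using n assms(2) by (intro mult_left_mono) auto
      finally show ?thesis .
    qed
    ultimately have "(C * k) * (n choose (k - 1)) \<le> \<epsilon> * (k * (n choose k))"
      using mult_right_mono[of "C * k" "\<epsilon> * real (n - (k - 1))" "real (n choose (k - 1))"] by (simp add: mult.assoc)
    then have "k * (C * (n choose (k - 1))) \<le> k * (\<epsilon> * (n choose k))" by (simp add: mult_ac)
    then show ?thesis using assms(1) by simp
  qed
  then show ?thesis unfolding eventually_sequentially by blast
qed

lemma initseg_eq: "initseg L n = enumerate L ` {..<n}"
proof -
  have "{1..n} = Suc ` {..<n}" by (simp add: image_Suc_lessThan)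
  then show ?thesis by (simp add: initseg_def iel_def image_image)
qed

lemma sum_ksubsets_initseg:
  assumes L: "infinite L"
  shows "(\<Sum>s\<in>ksubsets (initseg L n) k. x s) = (\<Sum>t\<in>ksubsets {..<n} k. x (enumerate L ` t))"
proof -
  have inj: "inj (enumerate L)" using strict_mono_imp_inj_on[OF strict_mono_enumerate[OF L]] .
  have "ksubsets (initseg L n) k = (\<lambda>t. enumerate L ` t) ` ksubsets {..<n} k"
  proof (intro equalityI subsetI)
    fix s assume "s \<in> ksubsets (initseg L n) k"
    then have s: "finite s" "card s = k" "s \<subseteq> enumerate L ` {..<n}" by (auto simp: ksubsets_def initseg_eq)
    then obtain t where t: "t \<subseteq> {..<n}" "s = enumerate L ` t" by (auto simp: subset_image_iff)
    then have "t \<in> ksubsets {..<n} k"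
      using s inj by (auto simp: ksubsets_def card_image inj_on_subset finite_subset)
    then show "s \<in> (\<lambda>t. enumerate L ` t) ` ksubsets {..<n} k" using t by blast
  next
    fix s assume "s \<in> (\<lambda>t. enumerate L ` t) ` ksubsets {..<n} k"
    then show "s \<in> ksubsets (initseg L n) k"
      using inj by (auto simp: ksubsets_def initseg_eq card_image inj_on_subset)
  qed
  moreover have "inj_on (\<lambda>t. enumerate L ` t) (ksubsets {..<n} k)"
    using inj by (auto intro!: inj_onI simp: inj_image_eq_iff)
  ultimately show ?thesis by (simp add: sum.reindex)
qed

text \<open>Shifting a well spaced index set \<open>t\<close> by \<open>0, \<dots>, p - 1\<close> gives a plegma family, and all but
  \<open>O(n\<^sup>k\<^sup>-\<^sup>1)\<close> of the \<open>k\<close>-subsets of \<open>{..<n}\<close> are well spaced; hence each of the \<open>p\<close> members of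
  such a family is almost uniformly distributed, whatever the weights \<open>c\<close> are.\<close>

lemma sum_ksubsets_approx:
  fixes x :: "nat set \<Rightarrow> 'a::real_normed_vector"
  assumes k: "1 \<le> k" and K: "\<And>s. s \<in> ksubsets UNIV k \<Longrightarrow> norm (x s) \<le> K"
    and L: "infinite L" and p: "1 \<le> p" and c: "\<And>j. j < p \<Longrightarrow> 0 \<le> c j" "(\<Sum>j<p. c j) = 1"
    and near: "\<And>e. increasing_in L (k * p) e \<Longrightarrow> l \<le> e 0 \<Longrightarrow> norm (plegma_comb x k p c e - x0) \<le> \<epsilon>"
    and \<epsilon>: "0 \<le> \<epsilon>"
  shows "norm ((\<Sum>s\<in>ksubsets (initseg L n) k. x s) - real (n choose k) *\<^sub>R x0)
    \<le> \<epsilon> * (n choose k) + (K + norm x0) * real (l + p + k * p) * (n choose (k - 1))"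
proof -
  define T where "T = ksubsets {..<n} k"
  define good where "good t \<longleftrightarrow> (\<forall>a\<in>t. l \<le> a \<and> a + p \<le> n \<and> (\<forall>b\<in>t. a < b \<longrightarrow> a + p \<le> b))" for t
  define A where "A = {t \<in> T. good t}"
  define w where "w t = x (enumerate L ` t)" for t
  define sh where "sh j t = (\<lambda>a. a + j) ` t" for j and t :: "nat set"
  define S where "S = (\<Sum>t\<in>T. w t)"
  have finT: "finite T" and AT: "A \<subseteq> T" by (auto simp: T_def A_def finite_ksubsets)
  have inj: "inj (enumerate L)" using strict_mono_imp_inj_on[OF strict_mono_enumerate[OF L]] .
  have wK: "norm (w t) \<le> K" if "t \<in> T" for t
    unfolding w_def using that inj by (intro K) (auto simp: T_def ksubsets_def card_image inj_on_subset)
  have K0: "0 \<le> K" using K by (rule ksubsets_bound_nonneg)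
  have bad: "real (card (T - A)) \<le> real (l + p + k * p) * (n choose (k - 1))"
  proof -
    have "T - A = {t \<in> ksubsets {..<n} k. \<not> good t}" by (auto simp: A_def T_def)
    then have "card (T - A) \<le> (n choose (k - 1)) * (l + p + k * p)"
      using card_badly_spaced_le[OF k, of n l p] by (simp add: good_def)
    then show ?thesis by (metis mult.commute of_nat_le_iff of_nat_mult)
  qed
  \<comment> \<open>Shifting by \<open>j\<close> maps \<open>A\<close> injectively into
    \<open>T\<close>; the sets of \<open>T\<close> that are missed are as many as the badly spaced
    ones, and each contributes at most \<open>K\<close>.\<close>
  have shift: "norm (S - (\<Sum>t\<in>A. w (sh j t))) \<le> K * card (T - A)" if j: "j < p" for j
  proof -
    have injsh: "inj_on (sh j) A"
      unfolding sh_def by (intro inj_onI) (simp add: inj_image_eq_iff)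
    have "sh j t \<in> T" if "t \<in> A" for t
    proof -
      have t: "finite t" "card t = k" "t \<subseteq> {..<n}" "good t"
        using that by (auto simp: A_def T_def ksubsets_def)
      have "a + j < n" if "a \<in> t" for a using t(4) that j by (force simp: good_def)
      then show ?thesis using t by (auto simp: T_def ksubsets_def sh_def card_image)
    qed
    then have sub: "sh j ` A \<subseteq> T" by blast
    have "(\<Sum>t\<in>A. w (sh j t)) = (\<Sum>t\<in>sh j ` A. w t)" by (simp add: sum.reindex[OF injsh])
    then have "S - (\<Sum>t\<in>A. w (sh j t)) = (\<Sum>t\<in>T - sh j ` A. w t)"
      unfolding S_def using sum_diff[OF finT sub, of w] by simp
    also have "norm \<dots> \<le> (\<Sum>t\<in>T - sh j ` A. K)" using wK by (intro sum_norm_le) auto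
    also have "\<dots> = K * card (T - A)"
      using card_Diff_subset[OF finite_subset[OF sub finT] sub]
        card_Diff_subset[OF finite_subset[OF AT finT] AT] card_image[OF injsh] by simp
    finally show ?thesis .
  qed
  have well: "norm ((\<Sum>j<p. c j *\<^sub>R w (sh j t)) - x0) \<le> \<epsilon>" if "t \<in> A" for t
  proof -
    have t: "t \<in> ksubsets UNIV k" "good t" using that by (auto simp: A_def T_def ksubsets_def)
    obtain e where e: "increasing_in L (k * p) e" "l \<le> e 0"
      "\<And>j. j < p \<Longrightarrow> strand k p e j = enumerate L ` (\<lambda>a. a + j) ` t"
      using shifted_strands[OF L t(1) p _ _ k, of l] t(2) by (auto simp: good_def)
    have "plegma_comb x k p c e = (\<Sum>j<p. c j *\<^sub>R w (sh j t))"
      unfolding plegma_comb_def w_def sh_def using e(3) by simp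
    then show ?thesis using near[OF e(1,2)] by simp
  qed
  have cardT: "real (card T) = real (n choose k)" by (simp add: T_def card_ksubsets)
  have cA: "real (card T) = real (card A) + real (card (T - A))"
    using card_Diff_subset[OF finite_subset[OF AT finT] AT] card_mono[OF finT AT] by simp
  \<comment> \<open>As the weights sum to 1, \<open>S\<close> is its own weighted average over the
    shifts.\<close>
  have "(\<Sum>j<p. c j *\<^sub>R (S - (\<Sum>t\<in>A. w (sh j t)))) = S - (\<Sum>t\<in>A. \<Sum>j<p. c j *\<^sub>R w (sh j t))"
    using c(2) sum.swap[of "\<lambda>j t. c j *\<^sub>R w (sh j t)" A "{..<p}"]
    by (simp add: scaleR_right_diff_distrib sum_subtractf scaleR_sum_right flip: scaleR_sum_left)
  \<comment> \<open>Three errors: the sets missed by the shifts, the deviation of each well spaced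
    plegma average from \<open>x0\<close>, and the copies of \<open>x0\<close> belonging to badly
    spaced sets.\<close>
  then have "S - real (card T) *\<^sub>R x0 = (\<Sum>j<p. c j *\<^sub>R (S - (\<Sum>t\<in>A. w (sh j t))))
      + (\<Sum>t\<in>A. (\<Sum>j<p. c j *\<^sub>R w (sh j t)) - x0) - real (card (T - A)) *\<^sub>R x0"
    by (simp add: sum_subtractf cA scaleR_left_distrib sum_constant_scaleR)
  also have "norm \<dots> \<le> norm (\<Sum>j<p. c j *\<^sub>R (S - (\<Sum>t\<in>A. w (sh j t))))
      + norm (\<Sum>t\<in>A. (\<Sum>j<p. c j *\<^sub>R w (sh j t)) - x0) + norm (real (card (T - A)) *\<^sub>R x0)"
    by (rule order_trans[OF norm_triangle_ineq4 add_right_mono[OF norm_triangle_ineq]])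
  also have "norm (\<Sum>j<p. c j *\<^sub>R (S - (\<Sum>t\<in>A. w (sh j t)))) \<le> (\<Sum>j<p. c j * (K * card (T - A)))"
    using shift c(1) by (intro sum_norm_le) (auto intro!: mult_left_mono)
  also have "\<dots> = K * card (T - A)" using c(2) by (simp add: sum_distrib_right[symmetric])
  also have "norm (\<Sum>t\<in>A. (\<Sum>j<p. c j *\<^sub>R w (sh j t)) - x0) \<le> (\<Sum>t\<in>A. \<epsilon>)"
    using well by (rule sum_norm_le)
  also have "(\<Sum>t\<in>A. \<epsilon>) \<le> \<epsilon> * card T"
    using \<epsilon> cA by (simp add: mult.commute mult_left_mono)
  finally have "norm (S - real (card T) *\<^sub>R x0) \<le> \<epsilon> * card T + (K + norm x0) * card (T - A)"
    by (simp add: algebra_simps)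
  also have "(K + norm x0) * card (T - A) \<le> (K + norm x0) * (real (l + p + k * p) * (n choose (k - 1)))"
    using bad K0 by (intro mult_left_mono) auto
  finally show ?thesis
    unfolding cardT S_def w_def T_def sum_ksubsets_initseg[OF L] by (simp add: mult.assoc card_ksubsets)
qed

text \<open>\<open>p\<close>, \<open>c\<close> and \<open>l\<close> are fixed before
  \<open>n\<close>, so the boundary term of \<open>sum_ksubsets_approx\<close> is of order
  \<open>n choose (k - 1)\<close> and costs only another third of \<open>\<epsilon>\<close>.\<close>

lemma cesaro_summableI:
  fixes x :: "nat set \<Rightarrow> 'a::real_normed_vector"
  assumes k: "1 \<le> k" and K: "\<And>s. s \<in> ksubsets UNIV k \<Longrightarrow> norm (x s) \<le> K"
    and L: "infinite L"
    and approx: "\<And>\<epsilon>. 0 < \<epsilon> \<Longrightarrow> \<exists>p c l. 1 \<le> p \<and> (\<forall>j<p. 0 \<le> c j) \<and> (\<Sum>j<p. c j) = 1 \<and>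
      (\<forall>e. increasing_in L (k * p) e \<and> l \<le> e 0 \<longrightarrow> norm (plegma_comb x k p c e - x0) \<le> \<epsilon>)"
  shows "cesaro_summable x L k x0"
  unfolding cesaro_summable_def
proof (rule metric_LIMSEQ_I)
  fix \<epsilon> :: real assume \<epsilon>: "0 < \<epsilon>"
  then have \<epsilon>3: "0 < \<epsilon> / 3" by simp
  obtain p c l where pc: "1 \<le> p" "\<And>j. j < p \<Longrightarrow> 0 \<le> c j" "(\<Sum>j<p. c j) = 1"
    and near: "\<And>e. increasing_in L (k * p) e \<Longrightarrow> l \<le> e 0 \<Longrightarrow> norm (plegma_comb x k p c e - x0) \<le> \<epsilon> / 3"
    using approx[OF \<epsilon>3] by blast
  have K0: "0 \<le> K" using K by (rule ksubsets_bound_nonneg)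
  have "\<forall>\<^sub>F n in sequentially.
      (K + norm x0) * real (l + p + k * p) * (n choose (k - 1)) \<le> (\<epsilon> / 3) * (n choose k)"
    using K0 by (intro binomial_pred_negligible[OF k \<epsilon>3]) auto
  then obtain n0 where n0: "\<And>n. n0 \<le> n \<Longrightarrow>
      (K + norm x0) * real (l + p + k * p) * (n choose (k - 1)) \<le> (\<epsilon> / 3) * (n choose k)"
    unfolding eventually_sequentially by blast
  have "dist ((1 / real (n choose k)) *\<^sub>R (\<Sum>s\<in>ksubsets (initseg L n) k. x s)) x0 < \<epsilon>"
    if n: "max n0 k \<le> n" for n
  proof -
    let ?S = "\<Sum>s\<in>ksubsets (initseg L n) k. x s"
    have pos: "0 < real (n choose k)" using n by simp
    have "norm (?S - real (n choose k) *\<^sub>R x0) \<le> (\<epsilon> / 3) * (n choose k)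
        + (K + norm x0) * real (l + p + k * p) * (n choose (k - 1))"
      using \<epsilon>3 by (intro sum_ksubsets_approx[OF k K L pc near]) auto
    also have "\<dots> \<le> (2 * \<epsilon> / 3) * (n choose k)" using n0[of n] n by simp
    finally have le: "norm (?S - real (n choose k) *\<^sub>R x0) \<le> (2 * \<epsilon> / 3) * (n choose k)" .
    have "(1 / real (n choose k)) *\<^sub>R ?S - x0 = (1 / real (n choose k)) *\<^sub>R (?S - real (n choose k) *\<^sub>R x0)"
      using pos by (simp add: scaleR_right_diff_distrib)
    then have "dist ((1 / real (n choose k)) *\<^sub>R ?S) x0 = norm (?S - real (n choose k) *\<^sub>R x0) / (n choose k)"
      by (simp add: dist_norm)
    also have "\<dots> \<le> 2 * \<epsilon> / 3" using le pos by (simp add: field_simps)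
    also have "\<dots> < \<epsilon>" using \<epsilon> by simp
    finally show ?thesis .
  qed
  then show "\<exists>no. \<forall>n\<ge>no. dist ((1 / real (n choose k)) *\<^sub>R (\<Sum>s\<in>ksubsets (initseg L n) k. x s)) x0 < \<epsilon>"
    by blast
qed

section \<open>Iterated weak limits\<close>

text \<open>What Mazur's lemma makes of \<open>xx t\<close> being a weak cluster point of the points
  \<open>xx (insert v t)\<close>: norm approximation by convex combinations from every tail of
  \<open>M\<close>. Finiteness of \<open>I\<close> lets later elements be placed beyond it.\<close>

definition convex_approximable :: "(nat set \<Rightarrow> 'a::real_normed_vector) \<Rightarrow> nat set \<Rightarrow> nat set \<Rightarrow> bool" where
  "convex_approximable xx M t \<longleftrightarrow> (\<forall>l \<epsilon>. 0 < \<epsilon> \<longrightarrow> (\<exists>I\<subseteq>M \<inter> {l..}. finite I \<and>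
     (\<exists>y\<in>convex hull ((\<lambda>v. xx (insert v t)) ` I). norm (y - xx t) < \<epsilon>)))"

lemma convex_hull_image_finite:
  assumes "z \<in> convex hull (g ` A)"
  obtains I where "finite I" "I \<subseteq> A" "z \<in> convex hull (g ` I)"
proof -
  obtain S u where S: "finite S" "S \<subseteq> g ` A" "\<forall>v\<in>S. 0 \<le> u v" "sum u S = 1" "(\<Sum>v\<in>S. u v *\<^sub>R v) = z"
    using assms unfolding convex_hull_explicit by blast
  obtain I where I: "I \<subseteq> A" "finite I" "S = g ` I" using finite_subset_image[OF S(1,2)] by blast
  have "z \<in> convex hull S" unfolding convex_hull_explicit using S by blast
  then show thesis using that I by simp
qed

text \<open>Recursion on the number \<open>d\<close> of missing elements: a set with
  \<open>k - d\<close> elements receives a cluster point of the values at its one-point extensions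
  by larger elements of \<open>M\<close>.\<close>

lemma ex_iterated_weak_limits:
  fixes x :: "nat set \<Rightarrow> 'a::real_normed_vector"
  assumes K: "compactin weak_top K" "closedin weak_top K"
    and x: "\<And>s. s \<in> ksubsets UNIV k \<Longrightarrow> x s \<in> K" and M: "infinite M"
  obtains xx where "\<forall>t. finite t \<and> card t = k \<longrightarrow> xx t = x t"
    "\<forall>t. finite t \<and> card t < k \<longrightarrow> convex_approximable xx M t"
proof -
  \<comment> \<open>Only elements above \<open>t\<close> are inserted, so the insertion does raise
    the cardinality by one.\<close>
  define M' where "M' t = M \<inter> {n. \<forall>a\<in>t. a < n}" for t
  define lim where "lim g t y \<longleftrightarrow> y \<in> K \<and> (\<forall>l. y \<in> weak_top closure_of ((\<lambda>n. g (insert n t)) ` (M' t \<inter> {l..})))"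
    for g :: "nat set \<Rightarrow> 'a" and t y
  \<comment> \<open>\<open>X d\<close> is meant for sets with \<open>k - d\<close> elements; its
    values elsewhere are junk.\<close>
  define X where "X = rec_nat x (\<lambda>d g t. SOME y. lim g t y)"
  have X0: "X 0 = x" and XS: "X (Suc d) t = (SOME y. lim (X d) t y)" for d t by (simp_all add: X_def)
  have inf: "infinite (M' t)" if t: "finite t" for t
  proof
    assume "finite (M' t)"
    moreover obtain B where "\<forall>a\<in>t. a \<le> B" using t by (meson finite_nat_set_iff_bounded_le)
    then have "M \<subseteq> M' t \<union> {..B}" by (fastforce simp: M'_def)
    ultimately show False using M finite_subset by blast
  qed
  have card_ins: "card (insert n t) = Suc (card t)" if "n \<in> M' t" "finite t" for n t
  proof -
    have "n \<notin> t" using that(1) by (auto simp: M'_def)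
    then show ?thesis using that(2) by simp
  qed
  have limex: "lim (X d) t (X (Suc d) t)"
    if t: "finite t" "card t + Suc d = k" and XK: "\<And>s. finite s \<Longrightarrow> card s + d = k \<Longrightarrow> X d s \<in> K" for d t
  proof -
    have "\<exists>y\<in>K. \<forall>l. y \<in> weak_top closure_of ((\<lambda>n. X d (insert n t)) ` (M' t \<inter> {l..}))"
    proof (rule weakly_compact_cluster_point[OF K _ inf[OF t(1)]])
      fix n assume "n \<in> M' t"
      then show "X d (insert n t) \<in> K" using card_ins t by (intro XK) auto
    qed
    then have "\<exists>y. lim (X d) t y" unfolding lim_def by blast
    then show ?thesis unfolding XS by (rule someI_ex)
  qed
  have XK: "X d s \<in> K" if "finite s" "card s + d = k" for d s
    using that
  proof (induction d arbitrary: s)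
    case 0
    then show ?case using x by (simp add: X0 ksubsets_def)
  next
    case (Suc d)
    then show ?case using limex[of s d] by (auto simp: lim_def)
  qed
  define xx where "xx t = X (k - card t) t" for t
  show thesis
  proof
    show "\<forall>t. finite t \<and> card t = k \<longrightarrow> xx t = x t" by (simp add: xx_def X0)
    have "convex_approximable xx M t" if t: "finite t" "card t < k" for t
      unfolding convex_approximable_def
    proof (intro allI impI)
      fix l and \<epsilon> :: real assume \<epsilon>: "0 < \<epsilon>"
      define d where "d = k - Suc (card t)"
      have d: "k - card t = Suc d" "card t + Suc d = k" using t by (auto simp: d_def)
      have xxins: "xx (insert n t) = X d (insert n t)" if "n \<in> M' t" for n
        using card_ins[OF that t(1)] by (simp add: xx_def d_def)
      have "lim (X d) t (xx t)" unfolding xx_def d using limex[OF t(1) d(2)] XK by blast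
      then have "xx t \<in> weak_top closure_of ((\<lambda>n. X d (insert n t)) ` (M' t \<inter> {l..}))"
        by (simp add: lim_def)
      from Mazur[OF this \<epsilon>] obtain y where
        y: "y \<in> convex hull ((\<lambda>n. X d (insert n t)) ` (M' t \<inter> {l..}))" "norm (y - xx t) < \<epsilon>" by blast
      from convex_hull_image_finite[OF y(1)] obtain I where
        I: "finite I" "I \<subseteq> M' t \<inter> {l..}" "y \<in> convex hull ((\<lambda>n. X d (insert n t)) ` I)" by blast
      have "(\<lambda>n. X d (insert n t)) ` I = (\<lambda>v. xx (insert v t)) ` I"
        using I(2) xxins by (intro image_cong) auto
      then show "\<exists>I\<subseteq>M \<inter> {l..}. finite I \<and>
          (\<exists>y\<in>convex hull ((\<lambda>v. xx (insert v t)) ` I). norm (y - xx t) < \<epsilon>)"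
        using I y(2) by (intro exI[of _ I]) (auto simp: M'_def)
    qed
    then show "\<forall>t. finite t \<and> card t < k \<longrightarrow> convex_approximable xx M t" by blast
  qed
qed

text \<open>The open \<open>\<delta>\<close>-neighbourhood of a convex set is convex, so containing
  \<open>S\<close> it contains the hull of \<open>S\<close>.\<close>

lemma convex_hull_near:
  fixes H :: "'a::real_normed_vector set"
  assumes "convex H" "\<And>s. s \<in> S \<Longrightarrow> \<exists>u\<in>H. norm (u - s) < \<delta>" "y \<in> convex hull S"
  shows "\<exists>u\<in>H. norm (u - y) < \<delta>"
proof -
  have "convex {y. \<exists>u\<in>H. norm (u - y) < \<delta>}"
  proof (rule convexI, clarify)
    fix y1 y2 u1 u2 and a b :: real
    assume u: "u1 \<in> H" "norm (u1 - y1) < \<delta>" "u2 \<in> H" "norm (u2 - y2) < \<delta>"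
      and ab: "0 \<le> a" "0 \<le> b" "a + b = 1"
    have "norm ((a *\<^sub>R u1 + b *\<^sub>R u2) - (a *\<^sub>R y1 + b *\<^sub>R y2)) = norm (a *\<^sub>R (u1 - y1) + b *\<^sub>R (u2 - y2))"
      by (simp add: algebra_simps)
    also have "\<dots> \<le> a * norm (u1 - y1) + b * norm (u2 - y2)"
      using norm_triangle_ineq[of "a *\<^sub>R (u1 - y1)" "b *\<^sub>R (u2 - y2)"] ab by simp
    also have "\<dots> < \<delta>" using u ab by (intro convex_bound_lt) auto
    finally have "norm ((a *\<^sub>R u1 + b *\<^sub>R u2) - (a *\<^sub>R y1 + b *\<^sub>R y2)) < \<delta>" .
    moreover have "a *\<^sub>R u1 + b *\<^sub>R u2 \<in> H" using u ab by (intro convexD[OF assms(1)]) auto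
    ultimately show "\<exists>u\<in>H. norm (u - (a *\<^sub>R y1 + b *\<^sub>R y2)) < \<delta>" by blast
  qed
  then have "convex hull S \<subseteq> {y. \<exists>u\<in>H. norm (u - y) < \<delta>}"
    using assms(2) by (intro hull_minimal) auto
  then show ?thesis using assms(3) by blast
qed

text \<open>The residue class is a strand of the identity map.\<close>

lemma card_residue_class: 
  assumes "r < m"
  shows "card {i::nat. i < k * m \<and> i mod m = r} = k"
  using strand_in_ksubsets[of UNIV k m id r] assms
  by (simp add: increasing_in_def strict_mono_on_def ksubsets_def strand_def)

text \<open>All positions outside the \<open>r\<close>-th strand are fixed while the \<open>r\<close>-th strand ranges over a finite
  set \<open>T\<close> whose convex hull comes close to the iterated limit; the positions are chosen one after
  the other, so each finite set of candidates can be placed before the next fixed position.\<close>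

lemma ex_replaceable_strand:
  fixes xx :: "nat set \<Rightarrow> 'a::real_normed_vector"
  assumes xx: "\<forall>t. finite t \<and> card t < k \<longrightarrow> convex_approximable xx M t"
    and M: "infinite M" and r: "r < m" and \<epsilon>: "0 < \<epsilon>" and n: "n \<le> k * m"
  shows "\<exists>G T. finite T \<and> (\<exists>y\<in>convex hull (xx ` T). norm (y - xx {}) < \<epsilon>) \<and>
    (\<forall>t\<in>T. \<exists>e. increasing_in (M \<inter> {l..}) n e \<and> (\<forall>i<n. i mod m \<noteq> r \<longrightarrow> e i = G i) \<and>
       t = e ` {i. i < n \<and> i mod m = r})"
  using n
proof (induction n)
  case 0
  show ?case
  \<comment> \<open>With no position filled, the only candidate is the empty set, whose value is the
    iterated limit itself.\<close>
  proof (rule exI[of _ id], rule exI[of _ "{{}}"], intro conjI ballI)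
    show "\<exists>y\<in>convex hull (xx ` {{}}). norm (y - xx {}) < \<epsilon>" using \<epsilon> by simp
    show "\<exists>e. increasing_in (M \<inter> {l..}) 0 e \<and> (\<forall>i<0. i mod m \<noteq> r \<longrightarrow> e i = id i) \<and>
        t = e ` {i. i < 0 \<and> i mod m = r}" if "t \<in> {{}}" for t
      using that by (simp add: increasing_in_def strict_mono_on_def)
  qed simp
next
  case (Suc n)
  then have "n \<le> k * m" by simp
  from Suc.IH[OF this]
  obtain G T y where T: "finite T" and y: "y \<in> convex hull (xx ` T)" "norm (y - xx {}) < \<epsilon>"
    and ex: "\<forall>t\<in>T. \<exists>e. increasing_in (M \<inter> {l..}) n e \<and> (\<forall>i<n. i mod m \<noteq> r \<longrightarrow> e i = G i) \<and>
       t = e ` {i. i < n \<and> i mod m = r}" by (elim exE conjE bexE) (rule that)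
  from bchoice[OF ex] obtain E where E0: "\<forall>t\<in>T. increasing_in (M \<inter> {l..}) n (E t) \<and>
      (\<forall>i<n. i mod m \<noteq> r \<longrightarrow> E t i = G i) \<and> t = E t ` {i. i < n \<and> i mod m = r}" ..
  have E: "increasing_in (M \<inter> {l..}) n (E t)" "i < n \<Longrightarrow> i mod m \<noteq> r \<Longrightarrow> E t i = G i"
    "t = E t ` {i. i < n \<and> i mod m = r}" if "t \<in> T" for t i
    using bspec[OF E0 that] by simp_all
  have "finite (\<Union>t\<in>T. E t ` {..<n})" using T by simp
  \<comment> \<open>\<open>B\<close> bounds the positions used so far by all candidates together, so
    one value beyond \<open>B\<close> extends every one of them.\<close>
  then obtain B where B: "\<forall>v\<in>(\<Union>t\<in>T. E t ` {..<n}). v \<le> B" by (meson finite_nat_set_iff_bounded_le)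
  have ext: "increasing_in (M \<inter> {l..}) (Suc n) ((E t)(n := v))"
    if "t \<in> T" "v \<in> M" "max l (Suc B) \<le> v" for t v
  proof -
    have "E t i < v" if "i < n" for i using B \<open>t \<in> T\<close> that \<open>max l (Suc B) \<le> v\<close> by force
    then show ?thesis
      using E(1)[OF that(1)] that
      by (auto simp: increasing_in_def strict_mono_on_def less_Suc_eq image_subset_iff)
  qed
  show ?case
  \<comment> \<open>A position outside strand \<open>r\<close> gets one common value; a position on
    it makes each candidate \<open>t\<close> branch into the sets \<open>insert v t\<close> with
    \<open>v\<close> in \<open>I t\<close>.\<close>
  proof (cases "n mod m = r")
    case False
    obtain v where v: "v \<in> M" "max l (Suc B) \<le> v" using M by (meson infinite_nat_iff_unbounded_le)
    have *: "{i. i < Suc n \<and> i mod m = r} = {i. i < n \<and> i mod m = r}"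
      using False by (auto simp: less_Suc_eq)
    have "\<exists>e. increasing_in (M \<inter> {l..}) (Suc n) e \<and> (\<forall>i<Suc n. i mod m \<noteq> r \<longrightarrow> e i = (G(n := v)) i) \<and>
       t = e ` {i. i < Suc n \<and> i mod m = r}" if t: "t \<in> T" for t
    proof (intro exI conjI)
      show "increasing_in (M \<inter> {l..}) (Suc n) ((E t)(n := v))" using ext t v by blast
      show "\<forall>i<Suc n. i mod m \<noteq> r \<longrightarrow> ((E t)(n := v)) i = (G(n := v)) i" using E(2)[OF t] by auto
      have "((E t)(n := v)) ` {i. i < n \<and> i mod m = r} = E t ` {i. i < n \<and> i mod m = r}"
        by (intro image_cong) auto
      then show "t = ((E t)(n := v)) ` {i. i < Suc n \<and> i mod m = r}" unfolding * using E(3)[OF t] by simp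
    qed
    then show ?thesis using T y by blast
  next
    case True
    have *: "{i. i < Suc n \<and> i mod m = r} = insert n {i. i < n \<and> i mod m = r}"
      using True by (auto simp: less_Suc_eq)
    \<comment> \<open>The part of \<open>\<epsilon>\<close> that the earlier approximations have not
      consumed.\<close>
    define \<delta> where "\<delta> = \<epsilon> - norm (y - xx {})"
    have \<delta>: "0 < \<delta>" using y(2) by (simp add: \<delta>_def)
    have "\<exists>I\<subseteq>M \<inter> {max l (Suc B)..}. finite I \<and>
        (\<exists>y\<in>convex hull ((\<lambda>v. xx (insert v t)) ` I). norm (y - xx t) < \<delta>)" if t: "t \<in> T" for t
    proof -
      have fin: "finite {i. i < n \<and> i mod m = r}" by simp
      \<comment> \<open>Position \<open>n\<close> of strand \<open>r\<close> is still open, so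
        \<open>t\<close> has fewer than \<open>k\<close> elements and is itself a limit of its
        extensions.\<close>
      have "insert n {i. i < n \<and> i mod m = r} \<subseteq> {i. i < k * m \<and> i mod m = r}"
        unfolding *[symmetric] using Suc.prems by (intro Collect_mono) simp
      then have "card (insert n {i. i < n \<and> i mod m = r}) \<le> k"
        by (subst card_residue_class[OF r, of k, symmetric]) (rule card_mono, simp)
      then have "card {i. i < n \<and> i mod m = r} < k" by (subst (asm) card_insert_disjoint) simp_all
      moreover have "card t \<le> card {i. i < n \<and> i mod m = r}" using E(3)[OF t] card_image_le[OF fin] by metis
      moreover have "finite t" using E(3)[OF t] fin finite_imageI by metis
      ultimately have "convex_approximable xx M t" using xx by simp
      then show ?thesis using \<delta> unfolding convex_approximable_def by blast
    qed
    then obtain I where I: "\<And>t. t \<in> T \<Longrightarrow> I t \<subseteq> M \<inter> {max l (Suc B)..}" "\<And>t. t \<in> T \<Longrightarrow> finite (I t)"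
      "\<And>t. t \<in> T \<Longrightarrow> \<exists>y\<in>convex hull ((\<lambda>v. xx (insert v t)) ` I t). norm (y - xx t) < \<delta>"
      by metis
    define T' where "T' = (\<Union>t\<in>T. (\<lambda>v. insert v t) ` I t)"
    have "finite T'" using T I(2) by (simp add: T'_def)
    moreover have "\<exists>u\<in>convex hull (xx ` T'). norm (u - xx {}) < \<epsilon>"
    proof -
      have "\<exists>u\<in>convex hull (xx ` T'). norm (u - y) < \<delta>"
      proof (rule convex_hull_near[OF convex_convex_hull _ y(1)])
        fix s assume "s \<in> xx ` T"
        then obtain t where t: "t \<in> T" "s = xx t" by blast
        have "(\<lambda>v. xx (insert v t)) ` I t \<subseteq> xx ` T'" using t by (auto simp: T'_def)
        then have "convex hull ((\<lambda>v. xx (insert v t)) ` I t) \<subseteq> convex hull (xx ` T')" by (rule hull_mono)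
        then show "\<exists>u\<in>convex hull (xx ` T'). norm (u - s) < \<delta>" using I(3)[OF t(1)] t(2) by blast
      qed
      then obtain u where u: "u \<in> convex hull (xx ` T')" "norm (u - y) < \<delta>" by blast
      have "norm (u - xx {}) \<le> norm (u - y) + norm (y - xx {})"
        using norm_triangle_ineq[of "u - y" "y - xx {}"] by simp
      also have "\<dots> < \<epsilon>" using u(2) by (simp add: \<delta>_def)
      finally show ?thesis using u(1) by blast
    qed
    moreover have "\<exists>e. increasing_in (M \<inter> {l..}) (Suc n) e \<and> (\<forall>i<Suc n. i mod m \<noteq> r \<longrightarrow> e i = G i) \<and>
       s = e ` {i. i < Suc n \<and> i mod m = r}" if "s \<in> T'" for s
    proof -
      obtain t v where t: "t \<in> T" "v \<in> I t" "s = insert v t" using \<open>s \<in> T'\<close> by (auto simp: T'_def)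
      show ?thesis
      proof (intro exI conjI)
        show "increasing_in (M \<inter> {l..}) (Suc n) ((E t)(n := v))"
          using I(1)[OF t(1)] t(2) by (intro ext[OF t(1)]) auto
        show "\<forall>i<Suc n. i mod m \<noteq> r \<longrightarrow> ((E t)(n := v)) i = G i"
          using E(2)[OF t(1)] True by (auto simp: less_Suc_eq)
        have "((E t)(n := v)) ` {i. i < n \<and> i mod m = r} = E t ` {i. i < n \<and> i mod m = r}"
          by (intro image_cong) auto
        then show "s = ((E t)(n := v)) ` {i. i < Suc n \<and> i mod m = r}"
          unfolding * image_insert using E(3)[OF t(1)] t(3) by (simp only: fun_upd_same)
      qed
    qed
    ultimately show ?thesis by blast
  qed
qed

section \<open>Replacing members of a plegma family by the iterated limit\<close>

lemma convex_affine_norm_le: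
  fixes w :: "'a::real_normed_vector"
  shows "convex {y. norm (w + c *\<^sub>R y) \<le> \<rho>}"
proof (rule convexI, clarify)
  fix y1 y2 and a b :: real
  assume y: "norm (w + c *\<^sub>R y1) \<le> \<rho>" "norm (w + c *\<^sub>R y2) \<le> \<rho>" and ab: "0 \<le> a" "0 \<le> b" "a + b = 1"
  have "w = a *\<^sub>R w + b *\<^sub>R w" using ab(3) by (metis scaleR_left_distrib scaleR_one)
  then have "w + c *\<^sub>R (a *\<^sub>R y1 + b *\<^sub>R y2) = a *\<^sub>R (w + c *\<^sub>R y1) + b *\<^sub>R (w + c *\<^sub>R y2)"
    by (simp add: scaleR_right_distrib mult.commute)
  also have "norm \<dots> \<le> a * norm (w + c *\<^sub>R y1) + b * norm (w + c *\<^sub>R y2)"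
    using norm_triangle_ineq[of "a *\<^sub>R (w + c *\<^sub>R y1)" "b *\<^sub>R (w + c *\<^sub>R y2)"] ab by simp
  also have "\<dots> \<le> \<rho>" using y ab by (intro convex_bound_le) auto
  finally show "norm (w + c *\<^sub>R (a *\<^sub>R y1 + b *\<^sub>R y2)) \<le> \<rho>" .
qed

text \<open>\<open>\<theta>\<close> bounds the limit superior of the norms as the families move to
  infinity; the slack \<open>\<epsilon>\<close> absorbs approximation errors, so replacing members
  does not raise \<open>\<theta>\<close>.\<close>

definition asymp_norm_le ::
  "(nat set \<Rightarrow> 'a::real_normed_vector) \<Rightarrow> nat \<Rightarrow> nat set \<Rightarrow> nat \<Rightarrow> (nat \<Rightarrow> real) \<Rightarrow> 'a \<Rightarrow> real \<Rightarrow> bool" where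
  "asymp_norm_le x k M m b z \<theta> \<longleftrightarrow> (\<forall>\<epsilon>>0. \<exists>l. \<forall>e. increasing_in (M \<inter> {l..}) (k * m) e \<longrightarrow>
     norm (plegma_comb x k m b e - z) \<le> \<theta> + \<epsilon>)"

text \<open>With the other members held fixed, the bound is a convex condition on the vector in
  place \<open>r\<close>, so it extends to convex combinations and, up to \<open>\<epsilon>\<close>,
  to \<open>xx {}\<close>. This settles one choice \<open>e0\<close> of the other members; small
  oscillation carries it over to all late families.\<close>

lemma asymp_norm_le_replace:
  fixes x :: "nat set \<Rightarrow> 'a::real_normed_vector"
  assumes xxk: "\<forall>t. finite t \<and> card t = k \<longrightarrow> xx t = x t"
    and xx: "\<forall>t. finite t \<and> card t < k \<longrightarrow> convex_approximable xx M t"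
    and M: "infinite M" and r: "r < m" and b: "\<And>j. j < m \<Longrightarrow> \<bar>b j\<bar> \<le> 1"
    and osc: "\<And>\<epsilon>. 0 < \<epsilon> \<Longrightarrow> \<exists>l. osc_le x k m \<epsilon> (z - b r *\<^sub>R xx {}) (M \<inter> {l..})"
    and le: "asymp_norm_le x k M m b z \<theta>"
  shows "asymp_norm_le x k M m (b(r := 0)) (z - b r *\<^sub>R xx {}) \<theta>"
  unfolding asymp_norm_le_def
proof (intro allI impI)
  fix \<epsilon> :: real assume "0 < \<epsilon>"
  then have \<epsilon>: "0 < \<epsilon> / 3" by simp
  let ?z = "z - b r *\<^sub>R xx {}" and ?b = "b(r := 0)"
  obtain l1 where l1: "\<And>e. increasing_in (M \<inter> {l1..}) (k * m) e \<Longrightarrow>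
      norm (plegma_comb x k m b e - z) \<le> \<theta> + \<epsilon> / 3"
    using le \<epsilon> unfolding asymp_norm_le_def by blast
  obtain l2 where l2: "osc_le x k m (\<epsilon> / 3) ?z (M \<inter> {l2..})" using osc[OF \<epsilon>] by blast
  define l where "l = max l1 l2"
  have sub: "M \<inter> {l..} \<subseteq> M \<inter> {l1..}" "M \<inter> {l..} \<subseteq> M \<inter> {l2..}" by (auto simp: l_def)
  from ex_replaceable_strand[where k = k and l = l, OF xx M r \<epsilon> order_refl]
  obtain G T y where y: "y \<in> convex hull (xx ` T)" "norm (y - xx {}) < \<epsilon> / 3"
    and T: "\<forall>t\<in>T. \<exists>e. increasing_in (M \<inter> {l..}) (k * m) e \<and>
      (\<forall>i<k * m. i mod m \<noteq> r \<longrightarrow> e i = G i) \<and> t = e ` {i. i < k * m \<and> i mod m = r}"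
    by (elim exE conjE bexE) (rule that)
  have "T \<noteq> {}" using y(1) by auto
  then obtain e0 where e0: "increasing_in (M \<inter> {l..}) (k * m) e0"
    and e0G: "\<And>i. i < k * m \<Longrightarrow> i mod m \<noteq> r \<Longrightarrow> e0 i = G i" using T by blast
  \<comment> \<open>The contribution of the fixed members; with coefficient \<open>r\<close> deleted
    it does not depend on the candidate in that place.\<close>
  define v where "v = plegma_comb x k m ?b e0"
  have "xx ` T \<subseteq> {y. norm ((v - z) + b r *\<^sub>R y) \<le> \<theta> + \<epsilon> / 3}"
  proof clarify
    fix t assume "t \<in> T"
    then obtain e where e: "increasing_in (M \<inter> {l..}) (k * m) e"
      and eG: "\<And>i. i < k * m \<Longrightarrow> i mod m \<noteq> r \<Longrightarrow> e i = G i" and t: "t = strand k m e r"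
      using T unfolding strand_def by blast
    have same: "strand k m e j = strand k m e0 j" if "j \<noteq> r" for j
      unfolding strand_def using that eG e0G by (intro image_cong) auto
    have "finite t" "card t = k" using strand_in_ksubsets[OF e r] t by (auto simp: ksubsets_def)
    then have "xx t = x (strand k m e r)" using xxk t by simp
    moreover have "plegma_comb x k m b e = b r *\<^sub>R x (strand k m e r) + v"
      unfolding v_def plegma_comb_def using r same
      by (simp add: sum.remove[of "{..<m}" r])
    ultimately have eq: "(v - z) + b r *\<^sub>R xx t = plegma_comb x k m b e - z" by simp
    show "norm ((v - z) + b r *\<^sub>R xx t) \<le> \<theta> + \<epsilon> / 3"
      unfolding eq by (rule l1[OF increasing_in_mono[OF e sub(1)]])
  qed
  then have "convex hull (xx ` T) \<subseteq> {y. norm ((v - z) + b r *\<^sub>R y) \<le> \<theta> + \<epsilon> / 3}"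
    by (intro hull_minimal convex_affine_norm_le)
  then have "norm ((v - z) + b r *\<^sub>R y) \<le> \<theta> + \<epsilon> / 3" using y(1) by blast
  moreover have "norm (b r *\<^sub>R (y - xx {})) \<le> \<epsilon> / 3"
  proof -
    have "\<bar>b r\<bar> * norm (y - xx {}) \<le> 1 * (\<epsilon> / 3)" using b[OF r] y(2) by (intro mult_mono) auto
    then show ?thesis by simp
  qed
  moreover have "norm (v - ?z) \<le> norm ((v - z) + b r *\<^sub>R y) + norm (b r *\<^sub>R (y - xx {}))"
  proof -
    have eq: "v - ?z = ((v - z) + b r *\<^sub>R y) - b r *\<^sub>R (y - xx {})" by (simp add: algebra_simps)
    show ?thesis unfolding eq by (rule norm_triangle_ineq4)
  qed
  ultimately have v: "norm (v - ?z) \<le> \<theta> + \<epsilon> / 3 + \<epsilon> / 3" by linarith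
  have "norm (plegma_comb x k m ?b e - ?z) \<le> \<theta> + \<epsilon>" if e: "increasing_in (M \<inter> {l..}) (k * m) e" for e
  proof -
    have "\<bar>norm (plegma_comb x k m ?b e - ?z) - norm (v - ?z)\<bar> \<le> \<epsilon> / 3"
      using l2[unfolded osc_le_def, rule_format, of ?b e e0] b
        increasing_in_mono[OF e sub(2)] increasing_in_mono[OF e0 sub(2)] by (simp add: v_def)
    then show ?thesis using v by linarith
  qed
  then show "\<exists>l. \<forall>e. increasing_in (M \<inter> {l..}) (k * m) e \<longrightarrow> norm (plegma_comb x k m ?b e - ?z) \<le> \<theta> + \<epsilon>"
    by blast
qed

text \<open>Members are replaced one at a time. The centre remains a multiple of
  \<open>xx {}\<close> throughout, hence the oscillation hypothesis for all multiples.\<close>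

lemma asymp_norm_le_replace_set:
  fixes x :: "nat set \<Rightarrow> 'a::real_normed_vector"
  assumes xxk: "\<forall>t. finite t \<and> card t = k \<longrightarrow> xx t = x t"
    and xx: "\<forall>t. finite t \<and> card t < k \<longrightarrow> convex_approximable xx M t"
    and M: "infinite M" and b: "\<And>j. j < m \<Longrightarrow> \<bar>b j\<bar> \<le> 1"
    and osc: "\<And>\<epsilon> c. 0 < \<epsilon> \<Longrightarrow> \<exists>l. osc_le x k m \<epsilon> (c *\<^sub>R xx {}) (M \<inter> {l..})"
    and le: "asymp_norm_le x k M m b 0 \<theta>"
    and P: "finite P" "P \<subseteq> {..<m}"
  shows "asymp_norm_le x k M m (\<lambda>j. if j \<in> P then 0 else b j) ((- (\<Sum>j\<in>P. b j)) *\<^sub>R xx {}) \<theta>"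
  using P
proof (induction P rule: finite_induct)
  case empty
  then show ?case using le by simp
next
  case (insert r P)
  let ?b = "\<lambda>j. if j \<in> P then 0 else b j"
  have z: "(- (\<Sum>j\<in>P. b j)) *\<^sub>R xx {} - ?b r *\<^sub>R xx {} = (- (\<Sum>j\<in>insert r P. b j)) *\<^sub>R xx {}"
    using insert.hyps by (simp add: algebra_simps)
  have upd: "?b(r := 0) = (\<lambda>j. if j \<in> insert r P then 0 else b j)" by auto
  have "asymp_norm_le x k M m (?b(r := 0)) ((- (\<Sum>j\<in>P. b j)) *\<^sub>R xx {} - ?b r *\<^sub>R xx {}) \<theta>"
  proof (rule asymp_norm_le_replace[OF xxk xx M])
    show "r < m" using insert.prems by simp
    show "asymp_norm_le x k M m ?b ((- (\<Sum>j\<in>P. b j)) *\<^sub>R xx {}) \<theta>" using insert by simp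
    show "\<exists>l. osc_le x k m \<epsilon> ((- (\<Sum>j\<in>P. b j)) *\<^sub>R xx {} - ?b r *\<^sub>R xx {}) (M \<inter> {l..})" if "0 < \<epsilon>" for \<epsilon>
      unfolding z by (rule osc[OF that])
  qed (use b in auto)
  then show ?case unfolding z upd .
qed

section \<open>Spreading models\<close>

text \<open>The norm is 1-Lipschitz in the centre, so a nearby \<open>zz i\<close> can stand in for
  \<open>z\<close>.\<close>

lemma osc_le_closure:
  fixes x :: "nat set \<Rightarrow> 'a::real_normed_vector"
  assumes osc: "\<And>n m z. m \<le> Suc n \<Longrightarrow> z \<in> insert 0 (zz ` {..n}) \<Longrightarrow>
       osc_le x k m (1 / Suc n) z (M \<inter> {enumerate M n..})"
    and z: "z \<in> closure (range zz)" and \<epsilon>: "0 < \<epsilon>"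
  shows "\<exists>l. osc_le x k m \<epsilon> z (M \<inter> {l..})"
proof -
  have \<epsilon>3: "0 < \<epsilon> / 3" using \<epsilon> by simp
  then obtain i where i: "norm (zz i - z) < \<epsilon> / 3"
    using z unfolding closure_approachable dist_norm by blast
  obtain n0 where n0: "1 / real (Suc n0) < \<epsilon> / 3" using nat_approx_posE[OF \<epsilon>3] by blast
  \<comment> \<open>A stage late enough to treat the length \<open>m\<close> and the centre
    \<open>zz i\<close> with accuracy \<open>\<epsilon> / 3\<close>.\<close>
  define n where "n = max (max m i) n0"
  have "1 / real (Suc n) \<le> 1 / real (Suc n0)" by (rule divide_left_mono) (auto simp: n_def)
  then have n: "1 / real (Suc n) \<le> \<epsilon> / 3" using n0 by linarith
  have o: "osc_le x k m (1 / Suc n) (zz i) (M \<inter> {enumerate M n..})"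
    by (rule osc) (auto simp: n_def)
  have near: "\<bar>norm (u - z) - norm (u - zz i)\<bar> \<le> \<epsilon> / 3" for u
  proof -
    have "\<bar>norm (u - z) - norm (u - zz i)\<bar> \<le> norm ((u - z) - (u - zz i))" by (rule norm_triangle_ineq3)
    also have "\<dots> = norm (zz i - z)" by simp
    finally show ?thesis using i by simp
  qed
  have "osc_le x k m \<epsilon> z (M \<inter> {enumerate M n..})"
    unfolding osc_le_def
  proof (intro allI impI)
    fix a :: "nat \<Rightarrow> real" and e e'
    assume *: "(\<forall>j<m. \<bar>a j\<bar> \<le> 1) \<and> increasing_in (M \<inter> {enumerate M n..}) (k * m) e \<and>
      increasing_in (M \<inter> {enumerate M n..}) (k * m) e'"
    have "\<bar>norm (plegma_comb x k m a e - zz i) - norm (plegma_comb x k m a e' - zz i)\<bar> \<le> 1 / Suc n"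
      using o * unfolding osc_le_def by blast
    then show "\<bar>norm (plegma_comb x k m a e - z) - norm (plegma_comb x k m a e' - z)\<bar> \<le> \<epsilon>"
      using near[of "plegma_comb x k m a e"] near[of "plegma_comb x k m a e'"] n by linarith
  qed
  then show ?thesis by blast
qed

lemma sum_plegma_eq_comb:
  assumes "\<And>j. j < m \<Longrightarrow> ss (Suc j) = strand k m e j"
  shows "(\<Sum>j=1..m. a j *\<^sub>R x (ss j)) = plegma_comb x k m (\<lambda>j. a (Suc j)) e"
proof -
  have "(\<Sum>j=1..m. a j *\<^sub>R x (ss j)) = (\<Sum>j<m. a (Suc j) *\<^sub>R x (ss (Suc j)))"
    by (simp add: sum.atLeast1_atMost_eq)
  then show ?thesis using assms by (simp add: plegma_comb_def)
qed

lemma ex_plegma_beyond: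
  assumes "infinite M" "1 \<le> m" "1 \<le> k"
  obtains ss where "plegma M k m ss" "iel M l \<le> fel (ss 1) 1"
proof -
  define e where "e i = enumerate M (i + l)" for i
  have e: "increasing_in M (k * m) e"
    using enumerate_mono[OF _ assms(1)] enumerate_in_set[OF assms(1)]
    by (auto simp: increasing_in_def strict_mono_on_def e_def)
  have "iel M l \<le> enumerate M l"
    unfolding iel_def using enumerate_mono_le_iff[OF assms(1)] by simp
  also have "\<dots> = fel (strand k m e 0) 1" using fel_strand[OF e, of 0 1] assms by (simp add: e_def)
  finally show thesis using plegma_strand[OF e assms(2)]
    by (intro that[of "\<lambda>j. strand k m e (j - 1)"]) auto
qed

text \<open>\<open>iel M l\<close> is \<open>enumerate M (l - 1)\<close>, so stage
  \<open>l - 1\<close> of the stabilisation applies; its error \<open>1 / Suc (l - 1)\<close> is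
  \<open>1 / l\<close>.\<close>

lemma plegma_norm_diff_le:
  fixes x :: "nat set \<Rightarrow> 'a::real_normed_vector"
  assumes k: "1 \<le> k"
    and osc: "\<And>n m. m \<le> Suc n \<Longrightarrow> osc_le x k m (1 / Suc n) 0 (M \<inter> {enumerate M n..})"
    and ml: "1 \<le> m" "m \<le> l" and ss: "plegma M k m ss" "iel M l \<le> fel (ss 1) 1"
    and ss': "plegma M k m ss'" "iel M l \<le> fel (ss' 1) 1" and a: "\<forall>j\<in>{1..m}. \<bar>a j\<bar> \<le> 1"
  shows "\<bar>norm (\<Sum>j=1..m. a j *\<^sub>R x (ss j)) - norm (\<Sum>j=1..m. a j *\<^sub>R x (ss' j))\<bar> \<le> 1 / real (Suc (l - 1))"
proof -
  obtain e where e: "increasing_in M (k * m) e" "\<And>j. j < m \<Longrightarrow> ss (Suc j) = strand k m e j"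
    "e 0 = fel (ss 1) 1" using plegma_imp_strand[OF ss(1) ml(1) k] by blast
  obtain e' where e': "increasing_in M (k * m) e'" "\<And>j. j < m \<Longrightarrow> ss' (Suc j) = strand k m e' j"
    "e' 0 = fel (ss' 1) 1" using plegma_imp_strand[OF ss'(1) ml(1) k] by blast
  have "increasing_in (M \<inter> {enumerate M (l - 1)..}) (k * m) e"
    "increasing_in (M \<inter> {enumerate M (l - 1)..}) (k * m) e'"
    using increasing_in_tail[OF e(1)] increasing_in_tail[OF e'(1)] e(3) e'(3) ss(2) ss'(2)
    by (auto simp: iel_def)
  moreover have "\<forall>j<m. \<bar>a (Suc j)\<bar> \<le> 1" using a by auto
  moreover have "osc_le x k m (1 / Suc (l - 1)) 0 (M \<inter> {enumerate M (l - 1)..})"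
    using ml by (intro osc) auto
  ultimately have "\<bar>norm (plegma_comb x k m (\<lambda>j. a (Suc j)) e - 0)
      - norm (plegma_comb x k m (\<lambda>j. a (Suc j)) e' - 0)\<bar> \<le> 1 / Suc (l - 1)"
    unfolding osc_le_def by (elim allE[of _ "\<lambda>j. a (Suc j)"]) blast
  moreover have "(\<Sum>j=1..m. a j *\<^sub>R x (ss j)) = plegma_comb x k m (\<lambda>j. a (Suc j)) e"
    "(\<Sum>j=1..m. a j *\<^sub>R x (ss' j)) = plegma_comb x k m (\<lambda>j. a (Suc j)) e'"
    by (intro sum_plegma_eq_comb e e'; assumption)+
  ultimately show ?thesis by (simp only: diff_zero)
qed

text \<open>One late family \<open>S n\<close> of each length \<open>Suc n\<close> suffices to
  define the seminorm as a limit: norms along families starting at or beyond \<open>M(l)\<close>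
  differ by at most \<open>1 / l\<close>, which gives convergence and then the comparison with every
  other family.\<close>

lemma ex_spreading_model:
  fixes x :: "nat set \<Rightarrow> 'a::real_normed_vector"
  assumes k: "1 \<le> k" and M: "infinite M"
    and osc: "\<And>n m. m \<le> Suc n \<Longrightarrow> osc_le x k m (1 / Suc n) 0 (M \<inter> {enumerate M n..})"
  obtains N where "generates_spreading_model x M k N"
proof -
  have "\<forall>n. \<exists>ss. plegma M k (Suc n) ss \<and> iel M (Suc n) \<le> fel (ss 1) 1"
    using ex_plegma_beyond[OF M _ k, of "Suc _"] by (metis Suc_eq_plus1 le_add2)
  then obtain S where S: "\<And>n. plegma M k (Suc n) (S n)" "\<And>n. iel M (Suc n) \<le> fel (S n 1) 1" by metis
  define V where "V n a = norm (\<Sum>j=1..Suc n. a j *\<^sub>R x (S n j))" for n and a :: "nat \<Rightarrow> real"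
  define N where "N a = lim (\<lambda>n. V n a)" for a
  have near: "\<bar>norm (\<Sum>j=1..m. a j *\<^sub>R x (ss j)) - V n a\<bar> \<le> 1 / real (Suc (l - 1))"
    if "1 \<le> m" "m \<le> l" "plegma M k m ss" "iel M l \<le> fel (ss 1) 1"
      "\<forall>j\<in>{1..m}. \<bar>a j\<bar> \<le> 1" "\<forall>j. j \<notin> {1..m} \<longrightarrow> a j = 0" "l \<le> n" for m l ss a n
  proof -
    have "V n a = norm (\<Sum>j=1..m. a j *\<^sub>R x (S n j))"
      unfolding V_def using that by (intro arg_cong[of _ _ norm] sum.mono_neutral_right) auto
    moreover have "plegma M k m (S n)" using that by (intro plegma_initial[OF S(1)]) auto
    moreover have "iel M l \<le> fel (S n 1) 1"
    proof -
      have "iel M l \<le> iel M (Suc n)" unfolding iel_def using enumerate_mono_le_iff[OF M] that by simp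
      then show ?thesis using S(2)[of n] by simp
    qed
    ultimately show ?thesis using plegma_norm_diff_le[OF k osc that(1-4) _ _ that(5)] by metis
  qed
  have conv1: "convergent (\<lambda>n. V n a)"
    if m: "1 \<le> m" and a: "\<forall>j. \<bar>a j\<bar> \<le> 1" "\<forall>j. j \<notin> {1..m} \<longrightarrow> a j = 0" for a m
  proof -
    have "Cauchy (\<lambda>n. V n a)"
    proof (rule metric_CauchyI)
      fix \<epsilon> :: real assume "0 < \<epsilon>"
      then have "0 < \<epsilon> / 2" by simp
      then obtain n0 where n0: "1 / real (Suc n0) < \<epsilon> / 2" by (rule nat_approx_posE)
      define l where "l = max m (Suc n0)"
      have "1 / real (Suc (l - 1)) \<le> 1 / real (Suc n0)" by (rule divide_left_mono) (auto simp: l_def)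
      then have l: "1 / real (Suc (l - 1)) < \<epsilon> / 2" using n0 by linarith
      obtain ss where ss: "plegma M k m ss" "iel M l \<le> fel (ss 1) 1" using ex_plegma_beyond[OF M m k] by blast
      have "dist (V n a) (V n' a) < \<epsilon>" if "l \<le> n" "l \<le> n'" for n n'
        using near[OF m _ ss _ a(2) that(1)] near[OF m _ ss _ a(2) that(2)] a(1) l
        unfolding dist_real_def by (smt (verit) field_sum_of_halves l_def max.cobounded1)
      then show "\<exists>L. \<forall>n\<ge>L. \<forall>n'\<ge>L. dist (V n a) (V n' a) < \<epsilon>" by blast
    qed
    then show ?thesis by (rule Cauchy_convergent)
  qed
  have Vscale: "V n (\<lambda>j. c * a j) = \<bar>c\<bar> * V n a" for n c a
  proof -
    have "(\<Sum>j=1..Suc n. (c * a j) *\<^sub>R x (S n j)) = c *\<^sub>R (\<Sum>j=1..Suc n. a j *\<^sub>R x (S n j))"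
      unfolding scaleR_sum_right by (intro sum.cong) auto
    then show ?thesis by (simp add: V_def)
  qed
  have conv: "(\<lambda>n. V n a) \<longlonglongrightarrow> N a" if fa: "fincoeff a" for a
  proof -
    obtain m where m: "\<And>j. a j \<noteq> 0 \<Longrightarrow> j \<in> {1..m}" using fa by (auto simp: fincoeff_def)
    \<comment> \<open>Scaling by \<open>1 / s\<close> brings the coefficients into the range covered
      by the stabilisation; the summand 1 keeps \<open>s\<close> positive for
      \<open>a = 0\<close>.\<close>
    define s where "s = 1 + (\<Sum>j\<in>{1..m}. \<bar>a j\<bar>)"
    have s: "0 < s" unfolding s_def by (intro add_pos_nonneg sum_nonneg) auto
    have "\<bar>a j\<bar> \<le> s" for j
    proof (cases "j \<in> {1..m}")
      case True
      have "\<bar>a j\<bar> \<le> (\<Sum>j\<in>{1..m}. \<bar>a j\<bar>)"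
        using True by (intro member_le_sum) auto
      then show ?thesis by (simp add: s_def)
    next
      case False
      then show ?thesis using m[of j] s by force
    qed
    then have "\<forall>j. \<bar>(1 / s) * a j\<bar> \<le> 1" using s by (simp add: abs_mult field_simps)
    then have "convergent (\<lambda>n. V n (\<lambda>j. (1 / s) * a j))"
      using m by (intro conv1[of "Suc m"]) force+
    then have "convergent (\<lambda>n. \<bar>1 / s\<bar> * V n a)" unfolding Vscale .
    then have "convergent (\<lambda>n. V n a)" using s convergent_mult_const_iff[of "\<bar>1 / s\<bar>"] by simp
    then show ?thesis unfolding N_def convergent_LIMSEQ_iff .
  qed
  have "seminorm_on_E N"
    unfolding seminorm_on_E_def
  proof (intro conjI allI impI)
    fix a b assume ab: "fincoeff a \<and> fincoeff b"
    have fab: "fincoeff (\<lambda>j. a j + b j)"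
    proof -
      obtain m m' where m: "\<forall>j. a j \<noteq> 0 \<longrightarrow> j \<in> {1..m}" "\<forall>j. b j \<noteq> 0 \<longrightarrow> j \<in> {1..m'}"
        using ab by (auto simp: fincoeff_def)
      have "j \<in> {1..max m m'}" if "a j + b j \<noteq> 0" for j
      proof (cases "a j = 0")
        case True
        then show ?thesis using that m(2) by auto
      next
        case False
        then show ?thesis using m(1) by auto
      qed
      then show ?thesis unfolding fincoeff_def by blast
    qed
    have "V n (\<lambda>j. a j + b j) \<le> V n a + V n b" for n
      unfolding V_def scaleR_left_distrib sum.distrib by (rule norm_triangle_ineq)
    then show "N (\<lambda>j. a j + b j) \<le> N a + N b"
      using ab by (intro LIMSEQ_le[OF conv[OF fab] tendsto_add[OF conv conv]]) auto
  next
    fix a and c :: real assume a: "fincoeff a"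
    have "(\<lambda>n. V n (\<lambda>j. c * a j)) \<longlonglongrightarrow> \<bar>c\<bar> * N a"
      unfolding Vscale by (intro tendsto_intros conv a)
    then show "N (\<lambda>j. c * a j) = \<bar>c\<bar> * N a" unfolding N_def by (rule limI)
  qed
  moreover have "\<bar>norm (\<Sum>j=1..m. a j *\<^sub>R x (ss j)) - N a\<bar> \<le> 1 / real (Suc (l - 1))"
    if *: "1 \<le> m" "m \<le> l" "plegma M k m ss" "iel M l \<le> fel (ss 1) 1"
      "\<forall>j\<in>{1..m}. \<bar>a j\<bar> \<le> 1" "\<forall>j. j \<notin> {1..m} \<longrightarrow> a j = 0" for m l ss a
  proof -
    have "fincoeff a" unfolding fincoeff_def using *(6) by blast
    then have "(\<lambda>n. \<bar>norm (\<Sum>j=1..m. a j *\<^sub>R x (ss j)) - V n a\<bar>)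
        \<longlonglongrightarrow> \<bar>norm (\<Sum>j=1..m. a j *\<^sub>R x (ss j)) - N a\<bar>"
      by (intro tendsto_intros conv)
    then show ?thesis by (rule LIMSEQ_le_const2) (use near[OF *] in blast)
  qed
  moreover have "(\<lambda>l. 1 / real (Suc (l - 1))) \<longlonglongrightarrow> 0"
  proof -
    \<comment> \<open>\<open>l - 1\<close> is truncated at \<open>l = 0\<close>; dropping that term
      leaves the sequence \<open>1 / Suc l\<close>.\<close>
    have "(\<lambda>l. 1 / real (Suc (Suc l - 1))) \<longlonglongrightarrow> 0"
      using LIMSEQ_inverse_real_of_nat by (simp add: inverse_eq_divide)
    then show ?thesis by (rule LIMSEQ_imp_Suc)
  qed
  ultimately have "generates_spreading_model x M k N"
    unfolding generates_spreading_model_def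
    by (intro conjI exI[of _ "\<lambda>l. 1 / real (Suc (l - 1))"]) auto
  then show thesis by (rule that)
qed

section \<open>The spreading property and the estimates against the usual norm of l1\<close>

text \<open>A single \<open>l\<close> controls both the error and the admissible length, so it is
  chosen beyond a prescribed \<open>l0\<close> as well.\<close>

lemma generates_spreading_modelE:
  assumes "generates_spreading_model x M k N" "0 < \<epsilon>"
  obtains l where "1 \<le> l" "l0 \<le> l" "\<And>m ss a. 1 \<le> m \<Longrightarrow> m \<le> l \<Longrightarrow> plegma M k m ss \<Longrightarrow> iel M l \<le> fel (ss 1) 1 \<Longrightarrow>
    \<forall>j\<in>{1..m}. \<bar>a j\<bar> \<le> 1 \<Longrightarrow> \<forall>j. j \<notin> {1..m} \<longrightarrow> a j = 0 \<Longrightarrow>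
    \<bar>norm (\<Sum>j=1..m. a j *\<^sub>R x (ss j)) - N a\<bar> \<le> \<epsilon>"
proof -
  obtain \<delta> :: "nat \<Rightarrow> real" where \<delta>: "\<delta> \<longlonglongrightarrow> 0"
    and gen: "\<And>l m ss a. 1 \<le> l \<and> 1 \<le> m \<and> m \<le> l \<and> plegma M k m ss \<and> fel (ss 1) 1 \<ge> iel M l \<and>
          (\<forall>j\<in>{1..m}. \<bar>a j\<bar> \<le> 1) \<and> (\<forall>j. j \<notin> {1..m} \<longrightarrow> a j = 0) \<Longrightarrow>
          \<bar>norm (\<Sum>j=1..m. a j *\<^sub>R x (ss j)) - N a\<bar> \<le> \<delta> l"
    using assms(1) unfolding generates_spreading_model_def by blast
  have "eventually (\<lambda>l. \<delta> l < \<epsilon>) sequentially" using \<delta> assms(2) by (rule order_tendstoD)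
  then obtain l1 where l1: "\<And>l. l1 \<le> l \<Longrightarrow> \<delta> l < \<epsilon>" unfolding eventually_sequentially by blast
  define l where "l = max (max 1 l0) l1"
  have l: "1 \<le> l" "l0 \<le> l" "\<delta> l < \<epsilon>" using l1[of l] by (auto simp: l_def)
  show thesis
  proof (rule that[OF l(1,2)])
    fix m ss and a :: "nat \<Rightarrow> real"
    assume "1 \<le> m" "m \<le> l" "plegma M k m ss" "iel M l \<le> fel (ss 1) 1"
      "\<forall>j\<in>{1..m}. \<bar>a j\<bar> \<le> 1" "\<forall>j. j \<notin> {1..m} \<longrightarrow> a j = 0"
    then have "\<bar>norm (\<Sum>j=1..m. a j *\<^sub>R x (ss j)) - N a\<bar> \<le> \<delta> l" using l(1) by (intro gen) blast
    then show "\<bar>norm (\<Sum>j=1..m. a j *\<^sub>R x (ss j)) - N a\<bar> \<le> \<epsilon>" using l(3) by simp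
  qed
qed

text \<open>In a plegma family of length \<open>p + p\<close> the last \<open>p\<close> members form
  a plegma family that starts no earlier, so \<open>N a\<close> and \<open>N\<close> of the shifted
  coefficients are both close to the norm of the same vector.\<close>

lemma spreading_model_shift:
  assumes gen: "generates_spreading_model x M k N" and M: "infinite M" and k: "1 \<le> k" and p: "1 \<le> p"
    and a: "\<forall>j\<in>{1..p}. \<bar>a j\<bar> \<le> 1" "\<forall>j. j \<notin> {1..p} \<longrightarrow> a j = 0"
  shows "N (\<lambda>j. a (j - p)) = N a"
proof -
  have "\<bar>N (\<lambda>j. a (j - p)) - N a\<bar> \<le> \<epsilon>" if "0 < \<epsilon>" for \<epsilon>
  proof -
    have \<epsilon>2: "0 < \<epsilon> / 2" using that by simp
    obtain l where l: "1 \<le> l" "p + p \<le> l" and close: "\<And>m ss a. 1 \<le> m \<Longrightarrow> m \<le> l \<Longrightarrow> plegma M k m ss \<Longrightarrow>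
      iel M l \<le> fel (ss 1) 1 \<Longrightarrow> \<forall>j\<in>{1..m}. \<bar>a j\<bar> \<le> 1 \<Longrightarrow> \<forall>j. j \<notin> {1..m} \<longrightarrow> a j = 0 \<Longrightarrow>
      \<bar>norm (\<Sum>j=1..m. a j *\<^sub>R x (ss j)) - N a\<bar> \<le> \<epsilon> / 2"
      using generates_spreading_modelE[OF gen \<epsilon>2, of "p + p"] by blast
    obtain ss where ss: "plegma M k (p + p) ss" "iel M l \<le> fel (ss 1) 1"
      using ex_plegma_beyond[OF M _ k, of "p + p"] p by (metis trans_le_add1)
    have pl: "plegma M k p (\<lambda>j. ss (p + j))" using plegma_final[OF ss(1) p] .
    have ge: "iel M l \<le> fel (ss (p + 1)) 1"
    proof -
      have "fel (ss 1) 1 \<le> fel (ss (Suc j)) 1" if "Suc j \<le> p + p" for j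
        using that
      proof (induction j)
        case (Suc j)
        have "fel (ss (Suc j)) 1 < fel (ss (Suc (Suc j))) 1"
          using ss(1) Suc k by (auto simp: plegma_def)
        then show ?case using Suc by simp
      qed simp
      from this[of p] show ?thesis using ss(2) p by simp
    qed
    \<comment> \<open>Truncated subtraction gives \<open>a (j - p) = a 0\<close> for
      \<open>j \<le> p\<close>; this is what puts zeros in front.\<close>
    have a0: "a 0 = 0" using a(2) by simp
    have "(\<Sum>j=1..p + p. a (j - p) *\<^sub>R x (ss j)) = (\<Sum>j=p + 1..p + p. a (j - p) *\<^sub>R x (ss j))"
      using a0 by (intro sum.mono_neutral_right) auto
    also have "\<dots> = (\<Sum>j=1..p. a j *\<^sub>R x (ss (p + j)))"
      by (rule sum.reindex_bij_witness[of _ "\<lambda>j. p + j" "\<lambda>j. j - p"]) auto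
    finally have eq: "(\<Sum>j=1..p + p. a (j - p) *\<^sub>R x (ss j)) = (\<Sum>j=1..p. a j *\<^sub>R x (ss (p + j)))" .
    have a1: "\<bar>a j\<bar> \<le> 1" for j using a by (cases "j \<in> {1..p}") auto
    have tail: "\<forall>j. j \<notin> {1..p + p} \<longrightarrow> a (j - p) = 0"
    proof (intro allI impI)
      fix j assume "j \<notin> {1..p + p}"
      then have "j - p \<notin> {1..p}" by auto
      then show "a (j - p) = 0" using a(2) by blast
    qed
    have "\<bar>norm (\<Sum>j=1..p + p. a (j - p) *\<^sub>R x (ss j)) - N (\<lambda>j. a (j - p))\<bar> \<le> \<epsilon> / 2"
      using p l(2) a1 tail by (intro close[OF _ _ ss]) simp_all
    moreover have "\<bar>norm (\<Sum>j=1..p. a j *\<^sub>R x (ss (p + j))) - N a\<bar> \<le> \<epsilon> / 2"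
      using p l(2) ge by (intro close[OF _ _ pl _ a]) auto
    ultimately show ?thesis unfolding eq by linarith
  qed
  then have "\<bar>N (\<lambda>j. a (j - p)) - N a\<bar> \<le> 0" by (rule field_le_epsilon) simp
  then show ?thesis by simp
qed

lemma spreading_model_upper:
  assumes gen: "generates_spreading_model x M k N" and M: "infinite M" and k: "1 \<le> k" and p: "1 \<le> p"
    and K: "\<And>s. s \<in> ksubsets UNIV k \<Longrightarrow> norm (x s) \<le> K"
    and a: "\<forall>j\<in>{1..p}. \<bar>a j\<bar> \<le> 1" "\<forall>j. j \<notin> {1..p} \<longrightarrow> a j = 0"
  shows "N a \<le> K * (\<Sum>j=1..p. \<bar>a j\<bar>)"
proof (rule field_le_epsilon)
  fix \<epsilon> :: real assume \<epsilon>: "0 < \<epsilon>"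
  obtain l where l: "1 \<le> l" "p \<le> l" and close: "\<And>m ss a. 1 \<le> m \<Longrightarrow> m \<le> l \<Longrightarrow> plegma M k m ss \<Longrightarrow>
      iel M l \<le> fel (ss 1) 1 \<Longrightarrow> \<forall>j\<in>{1..m}. \<bar>a j\<bar> \<le> 1 \<Longrightarrow> \<forall>j. j \<notin> {1..m} \<longrightarrow> a j = 0 \<Longrightarrow>
      \<bar>norm (\<Sum>j=1..m. a j *\<^sub>R x (ss j)) - N a\<bar> \<le> \<epsilon>"
    using generates_spreading_modelE[OF gen \<epsilon>, of p] by blast
  obtain ss where ss: "plegma M k p ss" "iel M l \<le> fel (ss 1) 1"
    using ex_plegma_beyond[OF M p k] by blast
  have "norm (\<Sum>j=1..p. a j *\<^sub>R x (ss j)) \<le> (\<Sum>j=1..p. K * \<bar>a j\<bar>)"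
  proof (rule sum_norm_le)
    fix j assume "j \<in> {1..p}"
    then have "ss j \<in> ksubsets UNIV k" using ss(1) by (auto simp: plegma_def ksubsets_def)
    then show "norm (a j *\<^sub>R x (ss j)) \<le> K * \<bar>a j\<bar>" 
      using mult_left_mono[OF K, of "ss j" "\<bar>a j\<bar>"] by (simp add: mult.commute)
  qed
  then have "norm (\<Sum>j=1..p. a j *\<^sub>R x (ss j)) \<le> K * (\<Sum>j=1..p. \<bar>a j\<bar>)" by (simp add: sum_distrib_left)
  then show "N a \<le> K * (\<Sum>j=1..p. \<bar>a j\<bar>) + \<epsilon>"
    using close[OF p l(2) ss a] by linarith
qed

lemma fincoeffI: "\<forall>j. j \<notin> {1..m} \<longrightarrow> a j = 0 \<Longrightarrow> fincoeff a"
  unfolding fincoeff_def by blast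

text \<open>A lower \<open>\<ell>\<^sup>1\<close>-estimate on coefficient vectors of sum zero already suffices: apply it to
  \<open>a\<close> followed by a shifted copy of \<open>- a\<close>.\<close>

lemma equiv_l1_basisI:
  fixes x :: "nat set \<Rightarrow> 'a::real_normed_vector"
  assumes gen: "generates_spreading_model x M k N" and M: "infinite M" and k: "1 \<le> k"
    and K: "\<And>s. s \<in> ksubsets UNIV k \<Longrightarrow> norm (x s) \<le> K"
    and c: "0 < c" "\<And>m b. 1 \<le> m \<Longrightarrow> \<forall>j. \<bar>b j\<bar> \<le> 1 \<Longrightarrow> \<forall>j. j \<notin> {1..m} \<longrightarrow> b j = 0 \<Longrightarrow>
      (\<Sum>j=1..m. b j) = 0 \<Longrightarrow> c * (\<Sum>j=1..m. \<bar>b j\<bar>) \<le> N b"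
  shows "equiv_l1_basis N"
proof -
  have semi: "seminorm_on_E N" using gen by (simp add: generates_spreading_model_def)
  have Nadd: "N (\<lambda>j. a j + b j) \<le> N a + N b" if "fincoeff a" "fincoeff b" for a b
    using semi that by (auto simp: seminorm_on_E_def)
  have Nscale: "N (\<lambda>j. s * a j) = \<bar>s\<bar> * N a" if "fincoeff a" for s a
    using semi that by (auto simp: seminorm_on_E_def)
  have lower: "c * (\<Sum>j=1..p. \<bar>a j\<bar>) \<le> N a"
    if p: "1 \<le> p" and a: "\<forall>j. \<bar>a j\<bar> \<le> 1" "\<forall>j. j \<notin> {1..p} \<longrightarrow> a j = 0" for p a
  proof -
    define b where "b j = a j + (- 1) * a (j - p)" for j
    have a0: "a 0 = 0" using a(2) by simp
    have zero1: "a (j - p) = 0" if "j \<le> p" for j using that a0 by simp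
    have zero2: "a j = 0" if "p < j" for j using that a(2) by simp
    have b1: "\<forall>j. \<bar>b j\<bar> \<le> 1"
    proof
      fix j show "\<bar>b j\<bar> \<le> 1" using a(1) zero1[of j] zero2[of j] by (cases "j \<le> p") (auto simp: b_def)
    qed
    have tail: "\<forall>j. j \<notin> {1..p + p} \<longrightarrow> a (j - p) = 0"
    proof (intro allI impI)
      fix j assume "j \<notin> {1..p + p}"
      then have "j - p \<notin> {1..p}" by auto
      then show "a (j - p) = 0" using a(2) by blast
    qed
    moreover have "a j = 0" if "j \<notin> {1..p + p}" for j
    proof -
      have "j \<notin> {1..p}" using that by auto
      then show ?thesis using a(2) by blast
    qed
    ultimately have b2: "\<forall>j. j \<notin> {1..p + p} \<longrightarrow> b j = 0" by (simp add: b_def)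
    have split: "(\<Sum>j=1..p + p. f (b j)) = (\<Sum>j=1..p. f (a j)) + (\<Sum>j=1..p. f (- a j))"
      for f :: "real \<Rightarrow> real"
    proof -
      have "{1..p + p} = {1..p} \<union> {p + 1..p + p}" by auto
      then have "(\<Sum>j=1..p + p. f (b j)) = (\<Sum>j=1..p. f (b j)) + (\<Sum>j=p + 1..p + p. f (b j))"
        by (simp add: sum.union_disjoint)
      also have "(\<Sum>j=1..p. f (b j)) = (\<Sum>j=1..p. f (a j))"
        using zero1 by (intro sum.cong) (auto simp: b_def)
      also have "(\<Sum>j=p + 1..p + p. f (b j)) = (\<Sum>j=1..p. f (- a j))"
        using zero2 by (intro sum.reindex_bij_witness[of _ "\<lambda>j. p + j" "\<lambda>j. j - p"]) (auto simp: b_def)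
      finally show ?thesis .
    qed
    have fin: "fincoeff a" "fincoeff (\<lambda>j. a (j - p))" "fincoeff (\<lambda>j. (- 1) * a (j - p))"
      using a(2) tail by (auto intro!: fincoeffI[of p a] fincoeffI[of "p + p"])
    have "c * (\<Sum>j=1..p + p. \<bar>b j\<bar>) \<le> N b"
      using p b1 b2 split[of "\<lambda>v. v"] by (intro c(2)) (auto simp: sum_negf)
    \<comment> \<open>The mass of \<open>b\<close> is twice that of \<open>a\<close>, and
      \<open>N b \<le> 2 * N a\<close>, so the constant \<open>c\<close> carries over
      unchanged.\<close>
    then have "c * (2 * (\<Sum>j=1..p. \<bar>a j\<bar>)) \<le> N b" using split[of abs] by simp
    also have "N b \<le> N a + N (\<lambda>j. (- 1) * a (j - p))" unfolding b_def by (rule Nadd[OF fin(1,3)])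
    also have "N (\<lambda>j. (- 1) * a (j - p)) = N (\<lambda>j. a (j - p))" using Nscale[OF fin(2), of "- 1"] by simp
    also have "\<dots> = N a" using a by (intro spreading_model_shift[OF gen M k p]) auto
    finally show ?thesis by simp
  qed
  \<comment> \<open>\<open>K\<close> may be zero, whereas the upper constant has to be
    positive.\<close>
  define C where "C = K + 1"
  have "0 \<le> K" using K by (rule ksubsets_bound_nonneg)
  then have C: "0 < C" by (simp add: C_def)
  have "c * (\<Sum>j\<in>{j. a j \<noteq> 0}. \<bar>a j\<bar>) \<le> N a \<and> N a \<le> C * (\<Sum>j\<in>{j. a j \<noteq> 0}. \<bar>a j\<bar>)"
    if fa: "fincoeff a" for a
  proof -
    obtain m where m: "\<forall>j. a j \<noteq> 0 \<longrightarrow> j \<in> {1..m}" using fa by (auto simp: fincoeff_def)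
    define p where "p = Suc m"
    have p: "1 \<le> p" "\<forall>j. j \<notin> {1..p} \<longrightarrow> a j = 0" using m by (auto simp: p_def)
    define s where "s = (\<Sum>j=1..p. \<bar>a j\<bar>)"
    have sum_eq: "(\<Sum>j\<in>{j. a j \<noteq> 0}. \<bar>a j\<bar>) = s"
      unfolding s_def using p(2) by (intro sum.mono_neutral_left) auto
    have aj: "\<bar>a j\<bar> \<le> s" for j
    proof (cases "j \<in> {1..p}")
      case True
      then show ?thesis unfolding s_def by (intro member_le_sum) auto
    next
      case False
      then show ?thesis using p(2) by (simp add: s_def sum_nonneg)
    qed
    show ?thesis
    proof (cases "s = 0")
      case True
      then have "a = (\<lambda>j. 0 * a j)" using aj by (auto simp: fun_eq_iff)
      then have "N a = 0" using Nscale[OF fa, of 0] by simp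
      then show ?thesis using True sum_eq by simp
    next
      case False
      then have s: "0 < s" using aj[of 0] by (simp add: order.strict_iff_order)
      \<comment> \<open>Normalised to mass 1, the coefficients lie in \<open>[-1, 1]\<close>, where
        both estimates are available.\<close>
      define d where "d j = (1 / s) * a j" for j
      have d: "\<forall>j. \<bar>d j\<bar> \<le> 1" "\<forall>j. j \<notin> {1..p} \<longrightarrow> d j = 0"
        using aj p(2) s by (auto simp: d_def abs_mult)
      have sd: "(\<Sum>j=1..p. \<bar>d j\<bar>) = 1"
      proof -
        have "(\<Sum>j=1..p. \<bar>d j\<bar>) = (\<Sum>j=1..p. \<bar>a j\<bar>) / s"
          using s by (simp add: d_def abs_mult sum_divide_distrib)
        then show ?thesis using s unfolding s_def[symmetric] by simp
      qed
      have Nd: "N d = N a / s" unfolding d_def using Nscale[OF fa, of "1 / s"] s by simp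
      have "c \<le> N d" using lower[OF p(1) d] sd by simp
      moreover have "N d \<le> C"
      proof -
        have "N d \<le> K * (\<Sum>j=1..p. \<bar>d j\<bar>)"
          using d by (intro spreading_model_upper[OF gen M k p(1) K]) auto
        then show ?thesis using sd by (simp add: C_def)
      qed
      ultimately show ?thesis unfolding sum_eq Nd using s by (simp add: field_simps)
    qed
  qed
  then show ?thesis unfolding equiv_l1_basis_def using c(1) C by blast
qed

section \<open>The dichotomy\<close>

text \<open>Translates from 1-indexed plegma families to the 0-indexed code; the threshold is the
  element \<open>iel M l\<close>.\<close>

lemma asymp_norm_le_spreading_model:
  assumes gen: "generates_spreading_model x M k N" and k: "1 \<le> k" and m: "1 \<le> m"
    and b: "\<forall>j. \<bar>b j\<bar> \<le> 1" "\<forall>j. j \<notin> {1..m} \<longrightarrow> b j = 0"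
  shows "asymp_norm_le x k M m (\<lambda>j. b (Suc j)) 0 (N b)"
  unfolding asymp_norm_le_def
proof (intro allI impI)
  fix \<epsilon> :: real assume \<epsilon>: "0 < \<epsilon>"
  obtain l where l: "1 \<le> l" "m \<le> l" and close: "\<And>m ss a. 1 \<le> m \<Longrightarrow> m \<le> l \<Longrightarrow> plegma M k m ss \<Longrightarrow>
      iel M l \<le> fel (ss 1) 1 \<Longrightarrow> \<forall>j\<in>{1..m}. \<bar>a j\<bar> \<le> 1 \<Longrightarrow> \<forall>j. j \<notin> {1..m} \<longrightarrow> a j = 0 \<Longrightarrow>
      \<bar>norm (\<Sum>j=1..m. a j *\<^sub>R x (ss j)) - N a\<bar> \<le> \<epsilon>"
    using generates_spreading_modelE[OF gen \<epsilon>, of m] by blast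
  have "norm (plegma_comb x k m (\<lambda>j. b (Suc j)) e - 0) \<le> N b + \<epsilon>"
    if e: "increasing_in (M \<inter> {iel M l..}) (k * m) e" for e
  proof -
    have eM: "increasing_in M (k * m) e" using e by (rule increasing_in_mono) blast
    have "0 < k * m" using k m by simp
    then have "iel M l \<le> e 0" using e by (auto simp: increasing_in_def image_subset_iff)
    then have "iel M l \<le> fel (strand k m e (1 - 1)) 1" using fel_strand[OF eM, of 0 1] k m by simp
    then have "\<bar>norm (\<Sum>j=1..m. b j *\<^sub>R x (strand k m e (j - 1))) - N b\<bar> \<le> \<epsilon>"
      using b by (intro close[OF m l(2) plegma_strand[OF eM m]]) auto
    moreover have "(\<Sum>j=1..m. b j *\<^sub>R x (strand k m e (j - 1))) = plegma_comb x k m (\<lambda>j. b (Suc j)) e"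
      by (rule sum_plegma_eq_comb) simp
    ultimately show ?thesis by simp
  qed
  then show "\<exists>l. \<forall>e. increasing_in (M \<inter> {l..}) (k * m) e \<longrightarrow>
      norm (plegma_comb x k m (\<lambda>j. b (Suc j)) e - 0) \<le> N b + \<epsilon>" by blast
qed

text \<open>With \<open>m = 1\<close> there are no fixed positions, so
  \<open>ex_replaceable_strand\<close> approximates \<open>xx {}\<close> by convex combinations of
  values of \<open>x\<close>.\<close>

lemma iterated_limit_in_closure_span:
  fixes x :: "nat set \<Rightarrow> 'a::real_normed_vector"
  assumes xxk: "\<forall>t. finite t \<and> card t = k \<longrightarrow> xx t = x t"
    and xx: "\<forall>t. finite t \<and> card t < k \<longrightarrow> convex_approximable xx M t"
    and M: "infinite M"
  shows "xx {} \<in> closure (span (x ` ksubsets UNIV k))"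
  unfolding closure_approachable
proof (intro allI impI)
  fix \<epsilon> :: real assume \<epsilon>: "0 < \<epsilon>"
  from ex_replaceable_strand[where k = k and m = 1 and l = 0, OF xx M zero_less_one \<epsilon> order_refl]
  obtain G T y where y: "y \<in> convex hull (xx ` T)" "norm (y - xx {}) < \<epsilon>"
    and T: "\<forall>t\<in>T. \<exists>e. increasing_in (M \<inter> {0..}) (k * 1) e \<and>
      (\<forall>i<k * 1. i mod 1 \<noteq> 0 \<longrightarrow> e i = G i) \<and> t = e ` {i. i < k * 1 \<and> i mod 1 = 0}"
    by (elim exE conjE bexE) (rule that)
  have "xx ` T \<subseteq> x ` ksubsets UNIV k"
  proof clarify
    fix t assume "t \<in> T"
    then obtain e where e: "increasing_in (M \<inter> {0..}) (k * 1) e" "t = strand k 1 e 0"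
      using T unfolding strand_def by blast
    have "t \<in> ksubsets UNIV k"
      using strand_in_ksubsets[OF increasing_in_mono[OF e(1) subset_UNIV], of 0] e(2) by simp
    moreover then have "xx t = x t" using xxk by (simp add: ksubsets_def)
    ultimately show "xx t \<in> x ` ksubsets UNIV k" by simp
  qed
  then have "convex hull (xx ` T) \<subseteq> span (x ` ksubsets UNIV k)"
    by (intro hull_minimal subspace_imp_convex subspace_span) (use span_superset in blast)
  then show "\<exists>y\<in>span (x ` ksubsets UNIV k). dist y (xx {}) < \<epsilon>"
    using y by (auto simp: dist_norm)
qed

lemma countable_ksubsets: "countable (ksubsets UNIV k)"
proof -
  have "ksubsets UNIV k \<subseteq> {s. finite s}" by (auto simp: ksubsets_def)
  then show ?thesis using countable_Collect_finite countable_subset by blast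
qed

text \<open>Averaging out the negative members leaves mass \<open>s / 2\<close> on the positive ones
  and moves the centre to \<open>(s / 2) xx {}\<close>; rescaling by \<open>2 / s\<close> turns the
  error \<open>\<epsilon> s\<close> into \<open>2 \<epsilon>\<close>.\<close>

lemma ex_convex_plegma_comb_near:
  fixes x :: "nat set \<Rightarrow> 'a::real_normed_vector"
  assumes xxk: "\<forall>t. finite t \<and> card t = k \<longrightarrow> xx t = x t"
    and xx: "\<forall>t. finite t \<and> card t < k \<longrightarrow> convex_approximable xx M t"
    and M: "infinite M" and k: "1 \<le> k"
    and osc: "\<And>m \<epsilon> c. 0 < \<epsilon> \<Longrightarrow> \<exists>l. osc_le x k m \<epsilon> (c *\<^sub>R xx {}) (M \<inter> {l..})"
    and gen: "generates_spreading_model x M k N" and m: "1 \<le> m"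
    and b: "\<forall>j. \<bar>b j\<bar> \<le> 1" "\<forall>j. j \<notin> {1..m} \<longrightarrow> b j = 0" "(\<Sum>j=1..m. b j) = 0"
    and small: "N b < \<epsilon> * (\<Sum>j=1..m. \<bar>b j\<bar>)"
  shows "\<exists>c l. (\<forall>j<m. 0 \<le> c j) \<and> (\<Sum>j<m. c j) = 1 \<and>
    (\<forall>e. increasing_in M (k * m) e \<and> l \<le> e 0 \<longrightarrow> norm (plegma_comb x k m c e - xx {}) \<le> 2 * \<epsilon>)"
proof -
  define s where "s = (\<Sum>j=1..m. \<bar>b j\<bar>)"
  have Nscale: "N (\<lambda>j. r * b j) = \<bar>r\<bar> * N b" for r
    using gen fincoeffI[OF b(2)] by (auto simp: generates_spreading_model_def seminorm_on_E_def)
  have "0 \<le> s" unfolding s_def by (intro sum_nonneg) simp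
  \<comment> \<open>The strict inequality \<open>small\<close> rules out
    \<open>b = 0\<close>.\<close>
  moreover have "s \<noteq> 0"
  proof
    assume s0: "s = 0"
    then have "b j = 0" if "j \<in> {1..m}" for j
      using that unfolding s_def by (subst (asm) sum_nonneg_eq_0_iff) auto
    then have "(\<lambda>j. 0 * b j) = b" using b(2) by (auto simp: fun_eq_iff)
    then have "N b = 0" using Nscale[of 0] by simp
    then show False using small s0 by (simp add: s_def)
  qed
  ultimately have s: "0 < s" by simp
  define a where "a j = b (Suc j)" for j
  have sum_a: "(\<Sum>j<m. f (a j)) = (\<Sum>j=1..m. f (b j))" for f :: "real \<Rightarrow> real"
    unfolding a_def by (simp add: sum.atLeast1_atMost_eq)
  define P where "P = {j. j < m \<and> a j < 0}"
  define a' where "a' j = (if j \<in> P then 0 else a j)" for j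
  have P: "finite P" "P \<subseteq> {..<m}" by (auto simp: P_def)
  have a'0: "0 \<le> a' j" if "j < m" for j using that by (auto simp: a'_def P_def)
  have "(\<Sum>j<m. a j) = (\<Sum>j\<in>P. a j) + (\<Sum>j<m. a' j)"
  proof -
    have "(\<Sum>j<m. a' j) = (\<Sum>j\<in>{..<m} - P. a j)"
      unfolding a'_def by (intro sum.mono_neutral_cong_right) auto
    then show ?thesis using sum.subset_diff[OF P(2), of a] by simp
  qed
  moreover have "(\<Sum>j<m. \<bar>a j\<bar>) = (\<Sum>j<m. a' j) - (\<Sum>j\<in>P. a j)"
  proof -
    have "(\<Sum>j<m. a' j) = (\<Sum>j\<in>{..<m} - P. \<bar>a j\<bar>)"
      unfolding a'_def by (intro sum.mono_neutral_cong_right) (auto simp: P_def)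
    moreover have "(\<Sum>j\<in>P. \<bar>a j\<bar>) = - (\<Sum>j\<in>P. a j)"
      unfolding sum_negf[symmetric] by (intro sum.cong) (auto simp: P_def)
    ultimately show ?thesis using sum.subset_diff[OF P(2), of "\<lambda>j. \<bar>a j\<bar>"] by simp
  qed
  \<comment> \<open>Sum zero and total mass \<open>s\<close> make both parts equal to
    \<open>s / 2\<close>.\<close>
  ultimately have half: "(\<Sum>j<m. a' j) = s / 2" "- (\<Sum>j\<in>P. a j) = s / 2"
    using sum_a[of "\<lambda>v. v"] sum_a[of abs] b(3) by (simp_all add: s_def)
  have ab: "\<bar>a j\<bar> \<le> 1" if "j < m" for j using b(1) by (simp add: a_def)
  have le: "asymp_norm_le x k M m a 0 (N b)"
    unfolding a_def by (rule asymp_norm_le_spreading_model[OF gen k m b(1,2)])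
  have "asymp_norm_le x k M m a' ((s / 2) *\<^sub>R xx {}) (N b)"
    unfolding a'_def half(2)[symmetric]
    by (rule asymp_norm_le_replace_set[OF xxk xx M ab osc le P])
  \<comment> \<open>The strict gap left by \<open>small\<close> serves as the tolerance in
    \<open>asymp_norm_le\<close>.\<close>
  moreover have "0 < \<epsilon> * s - N b" using small by (simp add: s_def)
  ultimately obtain l where l: "\<And>e. increasing_in (M \<inter> {l..}) (k * m) e \<Longrightarrow>
      norm (plegma_comb x k m a' e - (s / 2) *\<^sub>R xx {}) \<le> N b + (\<epsilon> * s - N b)"
    unfolding asymp_norm_le_def by blast
  define c where "c j = (2 / s) * a' j" for j
  have "(\<Sum>j<m. c j) = 1" unfolding c_def sum_distrib_left[symmetric] half(1) using s by simp
  moreover have "\<forall>j<m. 0 \<le> c j" using a'0 s by (simp add: c_def)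
  moreover have "norm (plegma_comb x k m c e - xx {}) \<le> 2 * \<epsilon>"
    if e: "increasing_in M (k * m) e" "l \<le> e 0" for e
  proof -
    have le: "norm (plegma_comb x k m a' e - (s / 2) *\<^sub>R xx {}) \<le> \<epsilon> * s"
      using l[OF increasing_in_tail[OF e]] by simp
    have eq: "plegma_comb x k m c e - xx {} = (2 / s) *\<^sub>R (plegma_comb x k m a' e - (s / 2) *\<^sub>R xx {})"
      using s by (simp add: plegma_comb_def c_def scaleR_right_diff_distrib scaleR_sum_right)
    show ?thesis unfolding eq norm_scaleR using mult_left_mono[OF le, of "2 / s"] s by simp
  qed
  ultimately show ?thesis by blast
qed

theorem mainTheorem15:
  fixes x :: "nat set \<Rightarrow> 'a::banach" and k :: nat
  assumes "k \<ge> 1"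
    and "compactin weak_top (weak_top closure_of (x ` ksubsets UNIV k))"
  shows "\<exists>M. infinite M \<and>
           ((\<exists>N. generates_spreading_model x M k N \<and> equiv_l1_basis N) \<or>
            (\<exists>x0. \<forall>L. infinite L \<and> L \<subseteq> M \<longrightarrow> cesaro_summable x L k x0))"
proof -
  define W where "W = weak_top closure_of (x ` ksubsets UNIV k)"
  have W: "compactin weak_top W" "closedin weak_top W" using assms(2) by (simp_all add: W_def)
  have xW: "x s \<in> W" if "s \<in> ksubsets UNIV k" for s
    unfolding W_def using that by (intro subsetD[OF closure_of_subset]) auto
  obtain K where "\<forall>y\<in>W. norm y \<le> K" using compactin_weak_top_imp_bounded[OF W(1)] by (auto simp: bounded_iff)
  then have K: "norm (x s) \<le> K" if "s \<in> ksubsets UNIV k" for s using xW that by blast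
  \<comment> \<open>Fixed before \<open>M\<close> and \<open>xx\<close> exist; it will approximate
    every multiple of \<open>xx {}\<close>.\<close>
  obtain zz :: "nat \<Rightarrow> 'a" where zz: "span (x ` ksubsets UNIV k) \<subseteq> closure (range zz)"
    using span_separable[OF countable_image[OF countable_ksubsets]] by blast
  obtain M where M: "infinite M" and osc: "\<And>n m z. m \<le> Suc n \<Longrightarrow> z \<in> insert 0 (zz ` {..n}) \<Longrightarrow>
       osc_le x k m (1 / Suc n) z (M \<inter> {enumerate M n..})"
    using ex_asymptotic_subset[where k = k and x = x and K = K and zz = zz, OF K] by blast
  obtain N where N: "generates_spreading_model x M k N"
    using ex_spreading_model[OF assms(1) M osc] by blast
  obtain xx where xxk: "\<forall>t. finite t \<and> card t = k \<longrightarrow> xx t = x t"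
    and xx: "\<forall>t. finite t \<and> card t < k \<longrightarrow> convex_approximable xx M t"
    using ex_iterated_weak_limits[where k = k and x = x, OF W xW M] by blast
  have "closure (span (x ` ksubsets UNIV k)) \<subseteq> closure (range zz)"
    using zz by (simp add: closure_minimal)
  moreover have "c *\<^sub>R xx {} \<in> closure (span (x ` ksubsets UNIV k))" for c
  proof -
    have "c *\<^sub>R xx {} \<in> closure ((*\<^sub>R) c ` span (x ` ksubsets UNIV k))"
      using iterated_limit_in_closure_span[OF xxk xx M] by (auto simp flip: closure_scaleR)
    also have "\<dots> \<subseteq> closure (span (x ` ksubsets UNIV k))"
      by (intro closure_mono) (auto intro: span_scale)
    finally show ?thesis .
  qed
  ultimately have osc0: "\<exists>l. osc_le x k m \<epsilon> (c *\<^sub>R xx {}) (M \<inter> {l..})" if "0 < \<epsilon>" for m \<epsilon> c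
    using osc_le_closure[OF osc _ that] by blast
  show ?thesis
  proof (cases "\<exists>c>0. \<forall>m b. 1 \<le> m \<and> (\<forall>j. \<bar>b j\<bar> \<le> 1) \<and> (\<forall>j. j \<notin> {1..m} \<longrightarrow> b j = 0) \<and>
      (\<Sum>j=1..m. b j) = 0 \<longrightarrow> c * (\<Sum>j=1..m. \<bar>b j\<bar>) \<le> N b")
    case True
    then obtain c where c: "0 < c" "\<And>m b. 1 \<le> m \<Longrightarrow> \<forall>j. \<bar>b j\<bar> \<le> 1 \<Longrightarrow> \<forall>j. j \<notin> {1..m} \<longrightarrow> b j = 0 \<Longrightarrow>
      (\<Sum>j=1..m. b j) = 0 \<Longrightarrow> c * (\<Sum>j=1..m. \<bar>b j\<bar>) \<le> N b" by blast
    have "equiv_l1_basis N" by (rule equiv_l1_basisI[OF N M assms(1) K c])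
    then show ?thesis using M N by blast
  next
    case False
    have approx: "\<exists>p c l. 1 \<le> p \<and> (\<forall>j<p. 0 \<le> c j) \<and> (\<Sum>j<p. c j) = 1 \<and>
      (\<forall>e. increasing_in M (k * p) e \<and> l \<le> e 0 \<longrightarrow> norm (plegma_comb x k p c e - xx {}) \<le> \<epsilon>)"
      if \<epsilon>: "0 < \<epsilon>" for \<epsilon>
    proof -
      \<comment> \<open>The halving compensates the factor 2 in
        \<open>ex_convex_plegma_comb_near\<close>.\<close>
      have "0 < \<epsilon> / 2" using \<epsilon> by simp
      then obtain m b where "1 \<le> m" "\<forall>j. \<bar>b j\<bar> \<le> 1" "\<forall>j. j \<notin> {1..m} \<longrightarrow> b j = 0"
        "(\<Sum>j=1..m. b j) = 0" "N b < (\<epsilon> / 2) * (\<Sum>j=1..m. \<bar>b j\<bar>)"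
        using False by (meson not_le)
      from ex_convex_plegma_comb_near[OF xxk xx M assms(1) osc0 N this] \<open>1 \<le> m\<close>
      show ?thesis by auto
    qed
    have "cesaro_summable x L k (xx {})" if L: "infinite L" "L \<subseteq> M" for L
    proof (rule cesaro_summableI[OF assms(1) K L(1)])
      fix \<epsilon> :: real assume "0 < \<epsilon>"
      \<comment> \<open>Plegma families in \<open>L\<close> are plegma families in \<open>M\<close>,
        so the same \<open>p\<close>, \<open>c\<close> and \<open>l\<close> serve for every
        \<open>L\<close>.\<close>
      from approx[OF this] show "\<exists>p c l. 1 \<le> p \<and> (\<forall>j<p. 0 \<le> c j) \<and> (\<Sum>j<p. c j) = 1 \<and>
        (\<forall>e. increasing_in L (k * p) e \<and> l \<le> e 0 \<longrightarrow> norm (plegma_comb x k p c e - xx {}) \<le> \<epsilon>)"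
        using increasing_in_mono[OF _ L(2)] by meson
    qed
    then show ?thesis using M by blast
  qed
qed

end
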